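(* Let $U:\mathbb{C}\to\mathbb{D}$ be a left exact functor between finitely complete pointed categories which is endowed with a semi-direct index $\rho$. If, in addition, the functor $U$ is conservative, then the category $\mathbb{C}$ is protomodular (without any further assumption on the category $\mathbb{D}$).
   Context: Left exact means preserving finite limits; conservative means reflecting isomorphisms. A pointed category has a zero object, written $1$. For a category $\mathbb{E}$, $\mathrm{Pt}\,\mathbb{E}$ is the category whose objects are the split epimorphisms $(f,s):X\rightleftarrows Y$ in $\mathbb{E}$ (so $f:X\to Y$, $s:Y\to X$, $f s=\mathrm{Id}_Y$), and whose morphisms are the pairs of maps commuting with both the epimorphisms and their given sections. Let $U:\mathbb{C}\to\mathbb{D}$ be a left exact functor between finitely complete pointed categories. $\mathrm{Pt}_U:\mathrm{Pt}\,\mathbb{C}\to\mathrm{Pt}\,\mathbb{D}$ is its natural extension $(f,s)\mapsto(U(f),U(s))$. $W_U:\mathrm{Pt}\,\mathbb{C}\to\mathrm{Pt}\,\mathbb{D}$ is the functor sending $(f,s):X\rightleftarrows Y$ to the split epimorphism $(p_{U(Y)},\iota_{U(Y)}):U(Y)\times U(\mathrm{Ker} f)\rightleftarrows U(Y)$, where $p_{U(Y)}$ is the product projection and $\iota_{U(Y)}=(\mathrm{Id}_{U(Y)},0)$; on morphisms it is induced by the action on codomains and on kernels. A semi-direct index for $U$ is a natural isomorphism $\rho:\mathrm{Pt}_U\Rightarrow W_U$ whose component at each $(f,s):X\rightleftarrows Y$ is given by an isomorphism $\rho_{(f,s)}:U(X)\to U(Y)\times U(\mathrm{Ker} f)$ together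 with the identity on $U(Y)$, i.e. $p_{U(Y)}\rho_{(f,s)}=U(f)$ and $\rho_{(f,s)}U(s)=\iota_{U(Y)}$. A finitely complete category $\mathbb{E}$ is protomodular when, given any two horizontally composable commutative squares of vertical split epimorphisms (commuting with the epimorphisms and with the sections), the right hand square is a pullback as soon as the left hand square and the whole rectangle are pullbacks. Equivalently: for every $h:Y'\to Y$ the base-change (pullback) functor $h^*:\mathrm{Pt}_Y\mathbb{E}\to\mathrm{Pt}_{Y'}\mathbb{E}$ between the categories of split epimorphisms with fixed codomain is conservative. *)

theory Defs
  imports Main
begin

section \<open>Categories and functors\<close>

record ('o, 'm) cat =
  Obj :: "'o set"
  Arr :: "'m set"
  Dom :: "'m \<Rightarrow> 'o"
  Cod :: "'m \<Rightarrow> 'o"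
  Id :: "'o \<Rightarrow> 'm"
  Comp :: "'m \<Rightarrow> 'm \<Rightarrow> 'm"  (infixl "\<cdot>\<index>" 70)

definition hom :: "('o, 'm) cat \<Rightarrow> 'o \<Rightarrow> 'o \<Rightarrow> 'm set" where
  "hom C X Y = {f \<in> Arr C. Dom C f = X \<and> Cod C f = Y}"

locale category =
  fixes C :: "('o, 'm) cat" (structure)
  assumes Dom_in: "f \<in> Arr C \<Longrightarrow> Dom C f \<in> Obj C"
    and Cod_in: "f \<in> Arr C \<Longrightarrow> Cod C f \<in> Obj C"
    and Id_hom: "X \<in> Obj C \<Longrightarrow> Id C X \<in> hom C X X"
    and Comp_hom: "f \<in> hom C X Y \<Longrightarrow> g \<in> hom C Y Z \<Longrightarrow> g \<cdot> f \<in> hom C X Z"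
    and Id_right: "f \<in> hom C X Y \<Longrightarrow> f \<cdot> Id C X = f"
    and Id_left: "f \<in> hom C X Y \<Longrightarrow> Id C Y \<cdot> f = f"
    and assoc: "f \<in> hom C W X \<Longrightarrow> g \<in> hom C X Y \<Longrightarrow> h \<in> hom C Y Z \<Longrightarrow>
      h \<cdot> g \<cdot> f = h \<cdot> (g \<cdot> f)"

definition iso :: "('o, 'm) cat \<Rightarrow> 'm \<Rightarrow> bool" where
  "iso C f \<longleftrightarrow> f \<in> Arr C \<and>
     (\<exists>g \<in> hom C (Cod C f) (Dom C f).
        Comp C g f = Id C (Dom C f) \<and> Comp C f g = Id C (Cod C f))"

record ('o1, 'm1, 'o2, 'm2) funct =
  FObj :: "'o1 \<Rightarrow> 'o2"
  FArr :: "'m1 \<Rightarrow> 'm2"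

locale cat_functor = C: category C + D: category D
  for C :: "('o1, 'm1) cat" and D :: "('o2, 'm2) cat" +
  fixes F :: "('o1, 'm1, 'o2, 'm2) funct"
  assumes FObj_in: "X \<in> Obj C \<Longrightarrow> FObj F X \<in> Obj D"
    and FArr_hom: "f \<in> hom C X Y \<Longrightarrow> FArr F f \<in> hom D (FObj F X) (FObj F Y)"
    and FArr_Id: "X \<in> Obj C \<Longrightarrow> FArr F (Id C X) = Id D (FObj F X)"
    and FArr_Comp: "f \<in> hom C X Y \<Longrightarrow> g \<in> hom C Y Z \<Longrightarrow>
      FArr F (g \<cdot>\<^bsub>C\<^esub> f) = FArr F g \<cdot>\<^bsub>D\<^esub> FArr F f"

definition functor_comp ::
  "('o2, 'm2, 'o3, 'm3) funct \<Rightarrow> ('o1, 'm1, 'o2, 'm2) funct \<Rightarrow> ('o1, 'm1, 'o3, 'm3) funct" where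
  "functor_comp G F = \<lparr>FObj = FObj G \<circ> FObj F, FArr = FArr G \<circ> FArr F\<rparr>"

locale natural_iso = F: cat_functor C D F + G: cat_functor C D G
  for C :: "('o1, 'm1) cat" and D :: "('o2, 'm2) cat" and F and G +
  fixes \<tau> :: "'o1 \<Rightarrow> 'm2"
  assumes component_hom: "X \<in> Obj C \<Longrightarrow> \<tau> X \<in> hom D (FObj F X) (FObj G X)"
    and component_iso: "X \<in> Obj C \<Longrightarrow> iso D (\<tau> X)"
    and naturality: "f \<in> hom C X Y \<Longrightarrow> FArr G f \<cdot>\<^bsub>D\<^esub> \<tau> X = \<tau> Y \<cdot>\<^bsub>D\<^esub> FArr F f"

definition conservative ::
  "('o1, 'm1) cat \<Rightarrow> ('o2, 'm2) cat \<Rightarrow> ('o1, 'm1, 'o2, 'm2) funct \<Rightarrow> bool" where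
  "conservative C D U \<longleftrightarrow> cat_functor C D U \<and> (\<forall>f \<in> Arr C. iso D (FArr U f) \<longrightarrow> iso C f)"


section \<open>Finite limits\<close>

definition cone ::
  "('j, 'a) cat \<Rightarrow> ('o, 'm) cat \<Rightarrow> ('j, 'a, 'o, 'm) funct \<Rightarrow> 'o \<Rightarrow> ('j \<Rightarrow> 'm) \<Rightarrow> bool" where
  "cone J C F L \<pi> \<longleftrightarrow> L \<in> Obj C \<and>
     (\<forall>j \<in> Obj J. \<pi> j \<in> hom C L (FObj F j)) \<and>
     (\<forall>a \<in> Arr J. FArr F a \<cdot>\<^bsub>C\<^esub> \<pi> (Dom J a) = \<pi> (Cod J a))"

definition limit_cone ::
  "('j, 'a) cat \<Rightarrow> ('o, 'm) cat \<Rightarrow> ('j, 'a, 'o, 'm) funct \<Rightarrow> 'o \<Rightarrow> ('j \<Rightarrow> 'm) \<Rightarrow> bool" where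
  "limit_cone J C F L \<pi> \<longleftrightarrow> cone J C F L \<pi> \<and>
     (\<forall>T \<sigma>. cone J C F T \<sigma> \<longrightarrow>
        (\<exists>!u. u \<in> hom C T L \<and> (\<forall>j \<in> Obj J. \<pi> j \<cdot>\<^bsub>C\<^esub> u = \<sigma> j)))"

definition finite_category :: "('j, 'a) cat \<Rightarrow> bool" where
  "finite_category J \<longleftrightarrow> category J \<and> finite (Obj J) \<and> finite (Arr J)"

text \<open>Every finite category is isomorphic to one whose objects and arrows are natural numbers,
  so it suffices to let the shapes of finite diagrams range over \<^typ>\<open>(nat, nat) cat\<close>.\<close>

definition finitely_complete :: "('o, 'm) cat \<Rightarrow> bool" where
  "finitely_complete C \<longleftrightarrow> category C \<and>
     (\<forall>(J :: (nat, nat) cat) F. finite_category J \<and> cat_functor J C F \<longrightarrow>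
        (\<exists>L \<pi>. limit_cone J C F L \<pi>))"

definition left_exact ::
  "('o1, 'm1) cat \<Rightarrow> ('o2, 'm2) cat \<Rightarrow> ('o1, 'm1, 'o2, 'm2) funct \<Rightarrow> bool" where
  "left_exact C D U \<longleftrightarrow> cat_functor C D U \<and>
     (\<forall>(J :: (nat, nat) cat) F L \<pi>.
        finite_category J \<and> cat_functor J C F \<and> limit_cone J C F L \<pi> \<longrightarrow>
          limit_cone J D (functor_comp U F) (FObj U L) (\<lambda>j. FArr U (\<pi> j)))"

definition pullback_square :: "('o, 'm) cat \<Rightarrow> 'm \<Rightarrow> 'm \<Rightarrow> 'm \<Rightarrow> 'm \<Rightarrow> bool" where
  "pullback_square C p q f g \<longleftrightarrow>
     p \<in> hom C (Dom C q) (Dom C f) \<and> q \<in> hom C (Dom C p) (Dom C g) \<and>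
     f \<in> Arr C \<and> g \<in> hom C (Dom C g) (Cod C f) \<and>
     f \<cdot>\<^bsub>C\<^esub> p = g \<cdot>\<^bsub>C\<^esub> q \<and>
     (\<forall>T a b. a \<in> hom C T (Dom C f) \<and> b \<in> hom C T (Dom C g) \<and> f \<cdot>\<^bsub>C\<^esub> a = g \<cdot>\<^bsub>C\<^esub> b \<longrightarrow>
        (\<exists>!u. u \<in> hom C T (Dom C p) \<and> p \<cdot>\<^bsub>C\<^esub> u = a \<and> q \<cdot>\<^bsub>C\<^esub> u = b))"

definition is_product :: "('o, 'm) cat \<Rightarrow> 'o \<Rightarrow> 'o \<Rightarrow> 'm \<Rightarrow> 'm \<Rightarrow> bool" where
  "is_product C A B p q \<longleftrightarrow>
     p \<in> hom C (Dom C p) A \<and> q \<in> hom C (Dom C p) B \<and>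
     (\<forall>T a b. a \<in> hom C T A \<and> b \<in> hom C T B \<longrightarrow>
        (\<exists>!u. u \<in> hom C T (Dom C p) \<and> p \<cdot>\<^bsub>C\<^esub> u = a \<and> q \<cdot>\<^bsub>C\<^esub> u = b))"

definition product_choice ::
  "('o, 'm) cat \<Rightarrow> ('o \<Rightarrow> 'o \<Rightarrow> 'm) \<Rightarrow> ('o \<Rightarrow> 'o \<Rightarrow> 'm) \<Rightarrow> bool" where
  "product_choice C p q \<longleftrightarrow> (\<forall>A \<in> Obj C. \<forall>B \<in> Obj C. is_product C A B (p A B) (q A B))"

text \<open>The arrow into the chosen product of \<open>A\<close> and \<open>B\<close> with components \<open>a\<close> and \<open>b\<close>.\<close>

definition pairing ::
  "('o, 'm) cat \<Rightarrow> ('o \<Rightarrow> 'o \<Rightarrow> 'm) \<Rightarrow> ('o \<Rightarrow> 'o \<Rightarrow> 'm) \<Rightarrow> 'o \<Rightarrow> 'o \<Rightarrow> 'm \<Rightarrow> 'm \<Rightarrow> 'm" where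
  "pairing C p q A B a b =
     (THE u. u \<in> hom C (Dom C a) (Dom C (p A B)) \<and>
        p A B \<cdot>\<^bsub>C\<^esub> u = a \<and> q A B \<cdot>\<^bsub>C\<^esub> u = b)"


section \<open>Pointed categories and kernels\<close>

definition zero_object :: "('o, 'm) cat \<Rightarrow> 'o \<Rightarrow> bool" where
  "zero_object C Z \<longleftrightarrow> Z \<in> Obj C \<and>
     (\<forall>X \<in> Obj C. (\<exists>!f. f \<in> hom C X Z) \<and> (\<exists>!f. f \<in> hom C Z X))"

definition pointed :: "('o, 'm) cat \<Rightarrow> bool" where
  "pointed C \<longleftrightarrow> category C \<and> (\<exists>Z. zero_object C Z)"

definition zero_arrow :: "('o, 'm) cat \<Rightarrow> 'o \<Rightarrow> 'o \<Rightarrow> 'm" where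
  "zero_arrow C X Y =
     (THE z. \<exists>Z a b. zero_object C Z \<and> a \<in> hom C X Z \<and> b \<in> hom C Z Y \<and> z = b \<cdot>\<^bsub>C\<^esub> a)"

definition is_kernel :: "('o, 'm) cat \<Rightarrow> 'm \<Rightarrow> 'm \<Rightarrow> bool" where
  "is_kernel C f k \<longleftrightarrow>
     k \<in> hom C (Dom C k) (Dom C f) \<and> f \<cdot>\<^bsub>C\<^esub> k = zero_arrow C (Dom C k) (Cod C f) \<and>
     (\<forall>T t. t \<in> hom C T (Dom C f) \<and> f \<cdot>\<^bsub>C\<^esub> t = zero_arrow C T (Cod C f) \<longrightarrow>
        (\<exists>!u. u \<in> hom C T (Dom C k) \<and> k \<cdot>\<^bsub>C\<^esub> u = t))"

definition kernel_choice :: "('o, 'm) cat \<Rightarrow> ('m \<Rightarrow> 'm) \<Rightarrow> bool" where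
  "kernel_choice C \<kappa> \<longleftrightarrow> (\<forall>f \<in> Arr C. is_kernel C f (\<kappa> f))"


section \<open>The category of split epimorphisms\<close>

definition split_epi :: "('o, 'm) cat \<Rightarrow> 'm \<Rightarrow> 'm \<Rightarrow> bool" where
  "split_epi C f s \<longleftrightarrow> f \<in> Arr C \<and> s \<in> hom C (Cod C f) (Dom C f) \<and>
     f \<cdot>\<^bsub>C\<^esub> s = Id C (Cod C f)"

text \<open>A morphism of split epimorphisms is a pair of arrows, between the domains (\<open>top\<close>) and the
  codomains (\<open>base\<close>); it records its source and target.\<close>

datatype 'm pt_arr =
  PtArr (src: "'m \<times> 'm") (tgt: "'m \<times> 'm") (top: 'm) (base: 'm)

definition Pt :: "('o, 'm) cat \<Rightarrow> ('m \<times> 'm, 'm pt_arr) cat" where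
  "Pt C =
     \<lparr>Obj = {(f, s). split_epi C f s},
      Arr = {PtArr (f, s) (f', s') x y | f s f' s' x y.
               split_epi C f s \<and> split_epi C f' s' \<and>
               x \<in> hom C (Dom C f) (Dom C f') \<and> y \<in> hom C (Cod C f) (Cod C f') \<and>
               f' \<cdot>\<^bsub>C\<^esub> x = y \<cdot>\<^bsub>C\<^esub> f \<and> x \<cdot>\<^bsub>C\<^esub> s = s' \<cdot>\<^bsub>C\<^esub> y},
      Dom = src,
      Cod = tgt,
      Id = (\<lambda>(f, s). PtArr (f, s) (f, s) (Id C (Dom C f)) (Id C (Cod C f))),
      Comp = (\<lambda>b a. PtArr (src a) (tgt b) (top b \<cdot>\<^bsub>C\<^esub> top a) (base b \<cdot>\<^bsub>C\<^esub> base a))\<rparr>"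

definition pt_pullback :: "('o, 'm) cat \<Rightarrow> 'm pt_arr \<Rightarrow> bool" where
  "pt_pullback C a \<longleftrightarrow> pullback_square C (top a) (fst (src a)) (fst (tgt a)) (base a)"

definition protomodular :: "('o, 'm) cat \<Rightarrow> bool" where
  "protomodular C \<longleftrightarrow> finitely_complete C \<and>
     (\<forall>a \<in> Arr (Pt C). \<forall>b \<in> Arr (Pt C).
        tgt a = src b \<and> pt_pullback C a \<and> pt_pullback C (b \<cdot>\<^bsub>Pt C\<^esub> a) \<longrightarrow> pt_pullback C b)"


section \<open>Semi-direct indexes\<close>

definition Pt_map ::
  "('o1, 'm1, 'o2, 'm2) funct \<Rightarrow> ('m1 \<times> 'm1, 'm1 pt_arr, 'm2 \<times> 'm2, 'm2 pt_arr) funct" where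
  "Pt_map U =
     \<lparr>FObj = map_prod (FArr U) (FArr U),
      FArr = map_pt_arr (FArr U)\<rparr>"

definition ker_map :: "('o, 'm) cat \<Rightarrow> ('m \<Rightarrow> 'm) \<Rightarrow> 'm pt_arr \<Rightarrow> 'm" where
  "ker_map C \<kappa> a =
     (let k = \<kappa> (fst (src a)); k' = \<kappa> (fst (tgt a)) in
      THE u. u \<in> hom C (Dom C k) (Dom C k') \<and> k' \<cdot>\<^bsub>C\<^esub> u = top a \<cdot>\<^bsub>C\<^esub> k)"

text \<open>The functor sending \<open>(f, s) : X \<rightleftarrows> Y\<close> to \<open>U(Y) \<times> U(Ker f) \<rightleftarrows> U(Y)\<close> depends on a choice
  \<open>\<kappa>\<close> of kernels in \<open>C\<close> and a choice \<open>p, q\<close> of binary products (with their projections) in \<open>D\<close>.\<close>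

definition W_obj ::
  "('o1, 'm1) cat \<Rightarrow> ('o2, 'm2) cat \<Rightarrow> ('m1 \<Rightarrow> 'm1) \<Rightarrow> ('o2 \<Rightarrow> 'o2 \<Rightarrow> 'm2) \<Rightarrow>
   ('o2 \<Rightarrow> 'o2 \<Rightarrow> 'm2) \<Rightarrow> ('o1, 'm1, 'o2, 'm2) funct \<Rightarrow> 'm1 \<times> 'm1 \<Rightarrow> 'm2 \<times> 'm2" where
  "W_obj C D \<kappa> p q U = (\<lambda>(f, s).
     let Y = FObj U (Cod C f); K = FObj U (Dom C (\<kappa> f)) in
     (p Y K, pairing D p q Y K (Id D Y) (zero_arrow D Y K)))"

definition W_arr ::
  "('o1, 'm1) cat \<Rightarrow> ('o2, 'm2) cat \<Rightarrow> ('m1 \<Rightarrow> 'm1) \<Rightarrow> ('o2 \<Rightarrow> 'o2 \<Rightarrow> 'm2) \<Rightarrow>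
   ('o2 \<Rightarrow> 'o2 \<Rightarrow> 'm2) \<Rightarrow> ('o1, 'm1, 'o2, 'm2) funct \<Rightarrow> 'm1 pt_arr \<Rightarrow> 'm2 pt_arr" where
  "W_arr C D \<kappa> p q U a =
     (let f = fst (src a); f' = fst (tgt a);
          Y = FObj U (Cod C f); K = FObj U (Dom C (\<kappa> f));
          Y' = FObj U (Cod C f'); K' = FObj U (Dom C (\<kappa> f')) in
      PtArr (W_obj C D \<kappa> p q U (src a)) (W_obj C D \<kappa> p q U (tgt a))
        (pairing D p q Y' K'
           (FArr U (base a) \<cdot>\<^bsub>D\<^esub> p Y K) (FArr U (ker_map C \<kappa> a) \<cdot>\<^bsub>D\<^esub> q Y K))
        (FArr U (base a)))"

definition W_map ::
  "('o1, 'm1) cat \<Rightarrow> ('o2, 'm2) cat \<Rightarrow> ('m1 \<Rightarrow> 'm1) \<Rightarrow> ('o2 \<Rightarrow> 'o2 \<Rightarrow> 'm2) \<Rightarrow>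
   ('o2 \<Rightarrow> 'o2 \<Rightarrow> 'm2) \<Rightarrow> ('o1, 'm1, 'o2, 'm2) funct \<Rightarrow>
   ('m1 \<times> 'm1, 'm1 pt_arr, 'm2 \<times> 'm2, 'm2 pt_arr) funct" where
  "W_map C D \<kappa> p q U = \<lparr>FObj = W_obj C D \<kappa> p q U, FArr = W_arr C D \<kappa> p q U\<rparr>"

text \<open>The equations \<open>p \<rho> = U(f)\<close> and \<open>\<rho> U(s) = \<iota>\<close> for a component \<open>\<rho>\<close> are part of its being an
  arrow of \<open>Pt D\<close> that is the identity on codomains, and invertibility of \<open>\<rho>\<close> is part of its being
  an isomorphism of \<open>Pt D\<close>.\<close>

definition semi_direct_index ::
  "('o1, 'm1) cat \<Rightarrow> ('o2, 'm2) cat \<Rightarrow> ('m1 \<Rightarrow> 'm1) \<Rightarrow> ('o2 \<Rightarrow> 'o2 \<Rightarrow> 'm2) \<Rightarrow>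
   ('o2 \<Rightarrow> 'o2 \<Rightarrow> 'm2) \<Rightarrow> ('o1, 'm1, 'o2, 'm2) funct \<Rightarrow> ('m1 \<times> 'm1 \<Rightarrow> 'm2 pt_arr) \<Rightarrow> bool" where
  "semi_direct_index C D \<kappa> p q U \<rho> \<longleftrightarrow>
     natural_iso (Pt C) (Pt D) (Pt_map U) (W_map C D \<kappa> p q U) \<rho> \<and>
     (\<forall>(f, s) \<in> Obj (Pt C). base (\<rho> (f, s)) = Id D (FObj U (Cod C f)))"


section \<open>Well-definedness\<close>

text \<open>\<open>Pt C\<close> is a category and \<open>Pt_map U\<close> and \<open>W_map C D \<kappa> p q U\<close> are functors \<open>Pt C \<rightarrow> Pt D\<close>, so
  the functoriality contained in \<^locale>\<open>natural_iso\<close> does not restrict semi-direct indexes.\<close>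

lemma homD: "f \<in> hom C X Y \<Longrightarrow> f \<in> Arr C \<and> Dom C f = X \<and> Cod C f = Y"
  by (simp add: hom_def)

lemma Arr_hom: "f \<in> Arr C \<Longrightarrow> f \<in> hom C (Dom C f) (Cod C f)"
  by (simp add: hom_def)

lemma (in category) hom_Obj: "f \<in> hom C X Y \<Longrightarrow> X \<in> Obj C \<and> Y \<in> Obj C"
  using Dom_in Cod_in by (auto simp: hom_def)

lemma zero_objectD:
  assumes "zero_object C Z" "X \<in> Obj C"
  shows "\<exists>f. f \<in> hom C X Z" and "\<exists>f. f \<in> hom C Z X"
    and "f \<in> hom C X Z \<Longrightarrow> g \<in> hom C X Z \<Longrightarrow> f = g"
    and "f \<in> hom C Z X \<Longrightarrow> g \<in> hom C Z X \<Longrightarrow> f = g"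
  using assms unfolding zero_object_def by metis+

lemma (in category) zero_arrow_eq:
  assumes "zero_object C Z" and a: "a \<in> hom C X Z" and b: "b \<in> hom C Z Y"
  shows "zero_arrow C X Y = b \<cdot> a"
  unfolding zero_arrow_def
proof (rule the_equality)
  show "\<exists>Z' a' b'. zero_object C Z' \<and> a' \<in> hom C X Z' \<and> b' \<in> hom C Z' Y \<and> b \<cdot> a = b' \<cdot> a'"
    using assms by blast
next
  fix z
  assume "\<exists>Z' a' b'. zero_object C Z' \<and> a' \<in> hom C X Z' \<and> b' \<in> hom C Z' Y \<and> z = b' \<cdot> a'"
  then obtain Z' a' b' where Z': "zero_object C Z'" and a': "a' \<in> hom C X Z'"
    and b': "b' \<in> hom C Z' Y" and z: "z = b' \<cdot> a'"
    by metis
  obtain c where c: "c \<in> hom C Z Z'"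
    using zero_objectD(1)[OF Z'] hom_Obj[OF b] by metis
  have "c \<cdot> a = a'"
    using zero_objectD(3)[OF Z' _ Comp_hom[OF a c] a'] hom_Obj[OF a] by simp
  moreover have "b' \<cdot> c = b"
    using zero_objectD(4)[OF assms(1) _ Comp_hom[OF c b'] b] hom_Obj[OF b] by simp
  ultimately show "z = b \<cdot> a"
    using assoc[OF a c b'] z by simp
qed

lemma zero_arrow_factor:
  assumes "pointed C" "X \<in> Obj C" "Y \<in> Obj C"
  obtains Z a b where "zero_object C Z" "a \<in> hom C X Z" "b \<in> hom C Z Y"
    "zero_arrow C X Y = b \<cdot>\<^bsub>C\<^esub> a"
proof -
  interpret category C using assms(1) by (simp add: pointed_def)
  obtain Z where Z: "zero_object C Z" using assms(1) by (auto simp: pointed_def)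
  obtain a b where ab: "a \<in> hom C X Z" "b \<in> hom C Z Y"
    using zero_objectD(1)[OF Z assms(2)] zero_objectD(2)[OF Z assms(3)] by metis
  show ?thesis by (rule that[OF Z ab zero_arrow_eq[OF Z ab]])
qed

lemma zero_arrow_hom:
  assumes "pointed C" "X \<in> Obj C" "Y \<in> Obj C"
  shows "zero_arrow C X Y \<in> hom C X Y"
proof -
  interpret category C using assms(1) by (simp add: pointed_def)
  show ?thesis by (rule zero_arrow_factor[OF assms]) (simp add: Comp_hom)
qed

lemma zero_arrow_Comp_right:
  fixes C (structure)
  assumes "pointed C" "f \<in> hom C W X" "Y \<in> Obj C"
  shows "zero_arrow C X Y \<cdot>\<^bsub>C\<^esub> f = zero_arrow C W Y"
proof -
  interpret category C using assms(1) by (simp add: pointed_def)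
  obtain Z a b where *: "zero_object C Z" "a \<in> hom C X Z" "b \<in> hom C Z Y"
    "zero_arrow C X Y = b \<cdot> a"
    using zero_arrow_factor[OF assms(1) _ assms(3), of X] hom_Obj[OF assms(2)] by blast
  show ?thesis
    using zero_arrow_eq[OF *(1) Comp_hom[OF assms(2) *(2)] *(3)] assoc[OF assms(2) *(2,3)] *(4)
    by simp
qed

lemma zero_arrow_Comp_left:
  fixes C (structure)
  assumes "pointed C" "g \<in> hom C X Y" "W \<in> Obj C"
  shows "g \<cdot>\<^bsub>C\<^esub> zero_arrow C W X = zero_arrow C W Y"
proof -
  interpret category C using assms(1) by (simp add: pointed_def)
  obtain Z a b where *: "zero_object C Z" "a \<in> hom C W Z" "b \<in> hom C Z X"
    "zero_arrow C W X = b \<cdot> a"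
    using zero_arrow_factor[OF assms(1,3), of X] hom_Obj[OF assms(2)] by blast
  show ?thesis
    using zero_arrow_eq[OF *(1,2) Comp_hom[OF *(3) assms(2)]] assoc[OF *(2,3) assms(2)] *(4)
    by simp
qed

lemma Obj_Pt [simp]: "(f, s) \<in> Obj (Pt C) \<longleftrightarrow> split_epi C f s"
  by (simp add: Pt_def)

lemma Pt_hom_iff:
  "a \<in> hom (Pt C) (f, s) (f', s') \<longleftrightarrow>
     (\<exists>x y. a = PtArr (f, s) (f', s') x y \<and> split_epi C f s \<and> split_epi C f' s' \<and>
        x \<in> hom C (Dom C f) (Dom C f') \<and> y \<in> hom C (Cod C f) (Cod C f') \<and>
        f' \<cdot>\<^bsub>C\<^esub> x = y \<cdot>\<^bsub>C\<^esub> f \<and> x \<cdot>\<^bsub>C\<^esub> s = s' \<cdot>\<^bsub>C\<^esub> y)"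
  by (auto simp: Pt_def hom_def)

lemma Comp_Pt [simp]:
  "PtArr P' Q' x' y' \<cdot>\<^bsub>Pt C\<^esub> PtArr P Q x y = PtArr P Q' (x' \<cdot>\<^bsub>C\<^esub> x) (y' \<cdot>\<^bsub>C\<^esub> y)"
  by (simp add: Pt_def)

lemma Id_Pt [simp]: "Id (Pt C) (f, s) = PtArr (f, s) (f, s) (Id C (Dom C f)) (Id C (Cod C f))"
  by (simp add: Pt_def)

lemma split_epi_hom:
  "split_epi C f s \<Longrightarrow> f \<in> hom C (Dom C f) (Cod C f) \<and> s \<in> hom C (Cod C f) (Dom C f)"
  by (simp add: split_epi_def hom_def)

lemma (in category) category_Pt: "category (Pt C)"
proof
  fix a assume "a \<in> Arr (Pt C)"
  then show "Dom (Pt C) a \<in> Obj (Pt C)" and "Cod (Pt C) a \<in> Obj (Pt C)"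
    by (auto simp: Pt_def)
next
  fix P assume "P \<in> Obj (Pt C)"
  moreover obtain f s where P: "P = (f, s)" by (cases P)
  ultimately have se: "split_epi C f s" by simp
  note fs = split_epi_hom[OF se]
  show "Id (Pt C) P \<in> hom (Pt C) P P"
    unfolding P Pt_hom_iff Id_Pt using se fs hom_Obj Id_hom Id_left Id_right by metis
next
  fix a b P Q R
  assume a: "a \<in> hom (Pt C) P Q" and b: "b \<in> hom (Pt C) Q R"
  obtain f s f' s' f'' s'' where P: "P = (f, s)" "Q = (f', s')" "R = (f'', s'')"
    by (metis surj_pair)
  obtain x y where A: "a = PtArr (f, s) (f', s') x y" "split_epi C f s" "split_epi C f' s'"
    "x \<in> hom C (Dom C f) (Dom C f')" "y \<in> hom C (Cod C f) (Cod C f')"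
    "f' \<cdot> x = y \<cdot> f" "x \<cdot> s = s' \<cdot> y"
    using a unfolding P Pt_hom_iff by blast
  obtain x' y' where B: "b = PtArr (f', s') (f'', s'') x' y'" "split_epi C f'' s''"
    "x' \<in> hom C (Dom C f') (Dom C f'')" "y' \<in> hom C (Cod C f') (Cod C f'')"
    "f'' \<cdot> x' = y' \<cdot> f'" "x' \<cdot> s' = s'' \<cdot> y'"
    using b unfolding P Pt_hom_iff by blast
  note h = split_epi_hom[OF A(2)] split_epi_hom[OF A(3)] split_epi_hom[OF B(2)]
  have "f'' \<cdot> (x' \<cdot> x) = y' \<cdot> y \<cdot> f"
    using assoc[OF A(4) B(3)] assoc[OF A(4) _ B(4)] assoc[OF _ A(5) B(4)] h A(6) B(5) by metis
  moreover have "x' \<cdot> x \<cdot> s = s'' \<cdot> (y' \<cdot> y)"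
    using assoc[OF _ A(4) B(3)] assoc[OF A(5) _ B(3)] assoc[OF A(5) B(4)] h A(7) B(6) by metis
  ultimately show "b \<cdot>\<^bsub>Pt C\<^esub> a \<in> hom (Pt C) P R"
    unfolding P Pt_hom_iff A(1) B(1) Comp_Pt
    using A(2) B(2) Comp_hom[OF A(4) B(3)] Comp_hom[OF A(5) B(4)] by blast
next
  fix a P Q assume "a \<in> hom (Pt C) P Q"
  moreover obtain f s f' s' where P: "P = (f, s)" "Q = (f', s')"
    by (metis surj_pair)
  ultimately show "a \<cdot>\<^bsub>Pt C\<^esub> Id (Pt C) P = a" and "Id (Pt C) Q \<cdot>\<^bsub>Pt C\<^esub> a = a"
    by (auto simp: Pt_hom_iff Id_left Id_right)
next
  fix a b c P Q R S
  assume "a \<in> hom (Pt C) P Q" "b \<in> hom (Pt C) Q R" "c \<in> hom (Pt C) R S"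
  moreover obtain f s f' s' f'' s'' f3 s3
    where P: "P = (f, s)" "Q = (f', s')" "R = (f'', s'')" "S = (f3, s3)"
    by (metis surj_pair)
  ultimately show "c \<cdot>\<^bsub>Pt C\<^esub> b \<cdot>\<^bsub>Pt C\<^esub> a = c \<cdot>\<^bsub>Pt C\<^esub> (b \<cdot>\<^bsub>Pt C\<^esub> a)"
    by (auto simp: Pt_hom_iff assoc)
qed

lemma (in cat_functor) FArr_split_epi:
  assumes "split_epi C f s"
  shows "split_epi D (FArr F f) (FArr F s)"
    and "Dom D (FArr F f) = FObj F (Dom C f)" and "Cod D (FArr F f) = FObj F (Cod C f)"
proof -
  note h = split_epi_hom[OF assms]
  have Ff: "FArr F f \<in> hom D (FObj F (Dom C f)) (FObj F (Cod C f))"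
    and Fs: "FArr F s \<in> hom D (FObj F (Cod C f)) (FObj F (Dom C f))"
    using h FArr_hom by blast+
  show dc: "Dom D (FArr F f) = FObj F (Dom C f)" "Cod D (FArr F f) = FObj F (Cod C f)"
    using Ff by (simp_all add: hom_def)
  have "FArr F f \<cdot>\<^bsub>D\<^esub> FArr F s = Id D (FObj F (Cod C f))"
    using FArr_Comp[of s _ _ f] h assms C.hom_Obj FArr_Id unfolding split_epi_def by metis
  then show "split_epi D (FArr F f) (FArr F s)"
    using Ff Fs dc by (simp add: split_epi_def hom_def)
qed

lemma (in cat_functor) functor_Pt_map: "cat_functor (Pt C) (Pt D) (Pt_map F)"
proof -
  interpret PC: category "Pt C" by (rule C.category_Pt)
  interpret PD: category "Pt D" by (rule D.category_Pt)
  show ?thesis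
  proof
    fix P assume "P \<in> Obj (Pt C)"
    then show "FObj (Pt_map F) P \<in> Obj (Pt D)"
      by (cases P) (simp add: Pt_map_def FArr_split_epi)
  next
    fix a P Q assume a: "a \<in> hom (Pt C) P Q"
    obtain f s f' s' where P: "P = (f, s)" "Q = (f', s')"
      by (metis surj_pair)
    obtain x y where A: "a = PtArr (f, s) (f', s') x y" "split_epi C f s" "split_epi C f' s'"
      "x \<in> hom C (Dom C f) (Dom C f')" "y \<in> hom C (Cod C f) (Cod C f')"
      "f' \<cdot>\<^bsub>C\<^esub> x = y \<cdot>\<^bsub>C\<^esub> f" "x \<cdot>\<^bsub>C\<^esub> s = s' \<cdot>\<^bsub>C\<^esub> y"
      using a unfolding P Pt_hom_iff by blast
    note h = split_epi_hom[OF A(2)] split_epi_hom[OF A(3)]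
    have "FArr F f' \<cdot>\<^bsub>D\<^esub> FArr F x = FArr F y \<cdot>\<^bsub>D\<^esub> FArr F f"
      using A(4-6) h FArr_Comp by metis
    moreover have "FArr F x \<cdot>\<^bsub>D\<^esub> FArr F s = FArr F s' \<cdot>\<^bsub>D\<^esub> FArr F y"
      using A(4,5,7) h FArr_Comp by metis
    ultimately show "FArr (Pt_map F) a \<in> hom (Pt D) (FObj (Pt_map F) P) (FObj (Pt_map F) Q)"
      using A FArr_split_epi FArr_hom by (simp add: P Pt_map_def Pt_hom_iff)
  next
    fix P assume "P \<in> Obj (Pt C)"
    moreover obtain f s where P: "P = (f, s)" by (cases P)
    ultimately have se: "split_epi C f s" by simp
    then show "FArr (Pt_map F) (Id (Pt C) P) = Id (Pt D) (FObj (Pt_map F) P)"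
      using split_epi_hom[OF se] C.hom_Obj FArr_Id FArr_split_epi(2,3)[OF se]
      by (auto simp: P Pt_map_def)
  next
    fix a b P Q R
    assume "a \<in> hom (Pt C) P Q" and "b \<in> hom (Pt C) Q R"
    moreover obtain f s f' s' f'' s'' where P: "P = (f, s)" "Q = (f', s')" "R = (f'', s'')"
      by (metis surj_pair)
    ultimately show "FArr (Pt_map F) (b \<cdot>\<^bsub>Pt C\<^esub> a) =
        FArr (Pt_map F) b \<cdot>\<^bsub>Pt D\<^esub> FArr (Pt_map F) a"
      by (auto simp: Pt_map_def Pt_hom_iff FArr_Comp)
  qed
qed

lemma ex1_iff_eq_The: "\<exists>!u. Q u \<Longrightarrow> Q v \<longleftrightarrow> v = (THE u. Q u)"
  using theI'[of Q] the1_equality[of Q v] by auto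

lemma pairing_unique:
  assumes "product_choice C p q" "A \<in> Obj C" "B \<in> Obj C" "a \<in> hom C T A" "b \<in> hom C T B"
  shows "u \<in> hom C T (Dom C (p A B)) \<and> p A B \<cdot>\<^bsub>C\<^esub> u = a \<and> q A B \<cdot>\<^bsub>C\<^esub> u = b
    \<longleftrightarrow> u = pairing C p q A B a b"
proof -
  have ex1: "\<exists>!u. u \<in> hom C T (Dom C (p A B)) \<and> p A B \<cdot>\<^bsub>C\<^esub> u = a \<and> q A B \<cdot>\<^bsub>C\<^esub> u = b"
    using assms unfolding product_choice_def is_product_def by blast
  have T: "Dom C a = T" using assms(4) by (simp add: hom_def)
  show ?thesis
    unfolding pairing_def T by (rule ex1_iff_eq_The[OF ex1])
qed

lemma ker_map_unique:
  fixes C (structure)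
  assumes C: "pointed C" and \<kappa>: "kernel_choice C \<kappa>" and a: "a \<in> hom (Pt C) (f, s) (f', s')"
  shows "u \<in> hom C (Dom C (\<kappa> f)) (Dom C (\<kappa> f')) \<and> \<kappa> f' \<cdot>\<^bsub>C\<^esub> u = top a \<cdot>\<^bsub>C\<^esub> \<kappa> f
    \<longleftrightarrow> u = ker_map C \<kappa> a"
proof -
  interpret category C using C by (simp add: pointed_def)
  obtain x y where A: "a = PtArr (f, s) (f', s') x y" "split_epi C f s" "split_epi C f' s'"
    "x \<in> hom C (Dom C f) (Dom C f')" "y \<in> hom C (Cod C f) (Cod C f')"
    "f' \<cdot> x = y \<cdot> f" "x \<cdot> s = s' \<cdot> y"
    using a unfolding Pt_hom_iff by blast
  note h = split_epi_hom[OF A(2)] split_epi_hom[OF A(3)]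
  have k: "is_kernel C f (\<kappa> f)" and k': "is_kernel C f' (\<kappa> f')"
    using \<kappa> A(2,3) by (auto simp: kernel_choice_def split_epi_def)
  have kh: "\<kappa> f \<in> hom C (Dom C (\<kappa> f)) (Dom C f)"
    and k0: "f \<cdot> \<kappa> f = zero_arrow C (Dom C (\<kappa> f)) (Cod C f)"
    using k by (auto simp: is_kernel_def)
  have "f' \<cdot> (x \<cdot> \<kappa> f) = y \<cdot> (f \<cdot> \<kappa> f)"
    using assoc[OF kh A(4)] assoc[OF kh _ A(5)] h A(6) by metis
  also have "\<dots> = zero_arrow C (Dom C (\<kappa> f)) (Cod C f')"
    using k0 zero_arrow_Comp_left[OF C A(5)] hom_Obj[OF kh] by simp
  finally have ex1: "\<exists>!u. u \<in> hom C (Dom C (\<kappa> f)) (Dom C (\<kappa> f')) \<and> \<kappa> f' \<cdot> u = x \<cdot> \<kappa> f"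
    using k' Comp_hom[OF kh A(4)] unfolding is_kernel_def by blast
  show ?thesis
    unfolding ker_map_def Let_def A(1) fst_conv pt_arr.sel by (rule ex1_iff_eq_The[OF ex1])
qed

lemma functor_W:
  assumes "cat_functor C D U" and PC: "pointed C" and PD: "pointed D"
    and \<kappa>: "kernel_choice C \<kappa>" and pq: "product_choice D p q"
  shows "cat_functor (Pt C) (Pt D) (W_map C D \<kappa> p q U)"
proof -
  interpret cat_functor C D U by fact
  interpret PC: category "Pt C" by (rule C.category_Pt)
  interpret PD: category "Pt D" by (rule D.category_Pt)
  define Y where "Y f = FObj U (Cod C f)" for f
  define K where "K f = FObj U (Dom C (\<kappa> f))" for f
  define P where "P f = p (Y f) (K f)" for f
  define Q where "Q f = q (Y f) (K f)" for f
  define \<iota> where "\<iota> f = pairing D p q (Y f) (K f) (Id D (Y f)) (zero_arrow D (Y f) (K f))" for f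
  define t where "t a = pairing D p q (Y (fst (tgt a))) (K (fst (tgt a)))
    (FArr U (base a) \<cdot>\<^bsub>D\<^esub> P (fst (src a))) (FArr U (ker_map C \<kappa> a) \<cdot>\<^bsub>D\<^esub> Q (fst (src a)))" for a
  have WO: "FObj (W_map C D \<kappa> p q U) (f, s) = (P f, \<iota> f)" for f s
    by (simp add: W_map_def W_obj_def P_def \<iota>_def Y_def K_def Let_def)
  have WA: "FArr (W_map C D \<kappa> p q U) a =
      PtArr (FObj (W_map C D \<kappa> p q U) (src a)) (FObj (W_map C D \<kappa> p q U) (tgt a)) (t a) (FArr U (base a))"
    for a
    by (simp add: W_map_def W_arr_def t_def P_def Q_def Y_def K_def Let_def)
  have YK: "Y f \<in> Obj D" "K f \<in> Obj D" if "split_epi C f s" for f s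
  proof -
    have "is_kernel C f (\<kappa> f)"
      using \<kappa> that by (auto simp: kernel_choice_def split_epi_def)
    then show "Y f \<in> Obj D" "K f \<in> Obj D"
      using C.hom_Obj split_epi_hom[OF that] FObj_in unfolding Y_def K_def is_kernel_def by metis+
  qed
  have PQ: "P f \<in> hom D (Dom D (P f)) (Y f)" "Q f \<in> hom D (Dom D (P f)) (K f)"
    if "split_epi C f s" for f s
    using pq YK[OF that] unfolding P_def Q_def product_choice_def is_product_def by blast+
  have CodP: "Cod D (P f) = Y f" if "split_epi C f s" for f s
    using PQ[OF that] by (simp add: hom_def)
  have joint: "u = v"
    if "split_epi C f s" "u \<in> hom D T (Dom D (P f))" "v \<in> hom D T (Dom D (P f))"
      "P f \<cdot>\<^bsub>D\<^esub> u = P f \<cdot>\<^bsub>D\<^esub> v" "Q f \<cdot>\<^bsub>D\<^esub> u = Q f \<cdot>\<^bsub>D\<^esub> v" for f s T u v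
    using pairing_unique[OF pq YK[OF that(1)]
        D.Comp_hom[OF that(3) PQ(1)[OF that(1)]] D.Comp_hom[OF that(3) PQ(2)[OF that(1)]]]
      that(2-) unfolding P_def Q_def by metis
  have \<iota>: "\<iota> f \<in> hom D (Y f) (Dom D (P f))" "P f \<cdot>\<^bsub>D\<^esub> \<iota> f = Id D (Y f)"
    "Q f \<cdot>\<^bsub>D\<^esub> \<iota> f = zero_arrow D (Y f) (K f)"
    if "split_epi C f s" for f s
    using pairing_unique[OF pq YK[OF that] D.Id_hom[OF YK(1)[OF that]]
        zero_arrow_hom[OF PD YK[OF that]]]
    unfolding P_def Q_def \<iota>_def by blast+
  have se: "split_epi D (P f) (\<iota> f)" if "split_epi C f s" for f s
    using \<iota>[OF that] PQ[OF that] CodP[OF that] by (simp add: split_epi_def hom_def)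
  have km: "FArr U (ker_map C \<kappa> a) \<in> hom D (K f) (K f')"
    if "a \<in> hom (Pt C) (f, s) (f', s')" for a f s f' s'
    using ker_map_unique[OF PC \<kappa> that] FArr_hom unfolding K_def by blast
  have bs: "FArr U (base a) \<in> hom D (Y f) (Y f')" "split_epi C f s" "split_epi C f' s'"
    "src a = (f, s)" "tgt a = (f', s')"
    if "a \<in> hom (Pt C) (f, s) (f', s')" for a f s f' s'
    using that FArr_hom unfolding Pt_hom_iff Y_def by auto
  have t: "t a \<in> hom D (Dom D (P f)) (Dom D (P f'))"
    "P f' \<cdot>\<^bsub>D\<^esub> t a = FArr U (base a) \<cdot>\<^bsub>D\<^esub> P f"
    "Q f' \<cdot>\<^bsub>D\<^esub> t a = FArr U (ker_map C \<kappa> a) \<cdot>\<^bsub>D\<^esub> Q f"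
    if a: "a \<in> hom (Pt C) (f, s) (f', s')" for a f s f' s'
    using pairing_unique[OF pq YK[OF bs(3)[OF a]]
        D.Comp_hom[OF PQ(1)[OF bs(2)[OF a]] bs(1)[OF a]]
        D.Comp_hom[OF PQ(2)[OF bs(2)[OF a]] km[OF a]]] bs(4,5)[OF a]
    unfolding P_def[of f'] Q_def[of f'] t_def by (metis fst_conv)+
  show ?thesis
  proof
    fix S assume "S \<in> Obj (Pt C)"
    then show "FObj (W_map C D \<kappa> p q U) S \<in> Obj (Pt D)"
      using se by (cases S) (simp add: WO)
  next
    fix a S S' assume "a \<in> hom (Pt C) S S'"
    moreover obtain f s f' s' where S: "S = (f, s)" "S' = (f', s')"
      by (metis surj_pair)
    ultimately have a: "a \<in> hom (Pt C) (f, s) (f', s')" by simp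
    note b = bs[OF a] and ta = t[OF a]
    have "t a \<cdot>\<^bsub>D\<^esub> \<iota> f = \<iota> f' \<cdot>\<^bsub>D\<^esub> FArr U (base a)"
    proof (rule joint[OF b(3)])
      show "t a \<cdot>\<^bsub>D\<^esub> \<iota> f \<in> hom D (Y f) (Dom D (P f'))"
        using D.Comp_hom \<iota>(1)[OF b(2)] ta(1) by blast
      show "\<iota> f' \<cdot>\<^bsub>D\<^esub> FArr U (base a) \<in> hom D (Y f) (Dom D (P f'))"
        using D.Comp_hom \<iota>(1)[OF b(3)] b(1) by blast
      show "P f' \<cdot>\<^bsub>D\<^esub> (t a \<cdot>\<^bsub>D\<^esub> \<iota> f) = P f' \<cdot>\<^bsub>D\<^esub> (\<iota> f' \<cdot>\<^bsub>D\<^esub> FArr U (base a))"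
        using D.assoc[OF \<iota>(1)[OF b(2)] ta(1) PQ(1)[OF b(3)]]
          D.assoc[OF \<iota>(1)[OF b(2)] PQ(1)[OF b(2)] b(1)]
          D.assoc[OF b(1) \<iota>(1)[OF b(3)] PQ(1)[OF b(3)]]
          ta(2) \<iota>(2)[OF b(2)] \<iota>(2)[OF b(3)] D.Id_left[OF b(1)] D.Id_right[OF b(1)] by simp
      show "Q f' \<cdot>\<^bsub>D\<^esub> (t a \<cdot>\<^bsub>D\<^esub> \<iota> f) = Q f' \<cdot>\<^bsub>D\<^esub> (\<iota> f' \<cdot>\<^bsub>D\<^esub> FArr U (base a))"
        using D.assoc[OF \<iota>(1)[OF b(2)] ta(1) PQ(2)[OF b(3)]]
          D.assoc[OF \<iota>(1)[OF b(2)] PQ(2)[OF b(2)] km[OF a]]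
          D.assoc[OF b(1) \<iota>(1)[OF b(3)] PQ(2)[OF b(3)]]
          ta(3) \<iota>(3)[OF b(2)] \<iota>(3)[OF b(3)]
          zero_arrow_Comp_left[OF PD km[OF a] YK(1)[OF b(2)]]
          zero_arrow_Comp_right[OF PD b(1) YK(2)[OF b(3)]] by simp
    qed
    then show "FArr (W_map C D \<kappa> p q U) a \<in>
        hom (Pt D) (FObj (W_map C D \<kappa> p q U) S) (FObj (W_map C D \<kappa> p q U) S')"
      unfolding S WO Pt_hom_iff WA b(4,5)
      using se[OF b(2)] se[OF b(3)] ta b(1) CodP[OF b(2)] CodP[OF b(3)] by simp
  next
    fix S assume "S \<in> Obj (Pt C)"
    moreover obtain f s where S: "S = (f, s)" by (cases S)
    ultimately have f: "split_epi C f s" by simp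
    let ?i = "Id (Pt C) (f, s)"
    have i: "?i \<in> hom (Pt C) (f, s) (f, s)"
      using PC.Id_hom f by (simp del: Id_Pt)
    have k: "\<kappa> f \<in> hom C (Dom C (\<kappa> f)) (Dom C f)"
      using \<kappa> f by (auto simp: kernel_choice_def split_epi_def is_kernel_def)
    have "Id C (Dom C (\<kappa> f)) = ker_map C \<kappa> ?i"
      using ker_map_unique[OF PC \<kappa> i, of "Id C (Dom C (\<kappa> f))"] C.Id_left[OF k] C.Id_right[OF k]
        C.Id_hom C.hom_Obj[OF k] by simp
    then have UK: "FArr U (ker_map C \<kappa> ?i) = Id D (K f)"
      using FArr_Id C.hom_Obj[OF k] by (metis K_def)
    have UB: "FArr U (base ?i) = Id D (Y f)"
      using FArr_Id C.hom_Obj split_epi_hom[OF f] by (simp add: Y_def) blast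
    have d: "Dom D (P f) \<in> Obj D"
      using D.hom_Obj PQ(1)[OF f] by blast
    have "t ?i = Id D (Dom D (P f))"
      by (rule joint[OF f t(1)[OF i]])
        (simp_all add: t(2,3)[OF i] UK UB D.Id_hom[OF d] D.Id_left[OF PQ(1)[OF f]]
          D.Id_left[OF PQ(2)[OF f]] D.Id_right[OF PQ(1)[OF f]] D.Id_right[OF PQ(2)[OF f]] del: Id_Pt)
    then show "FArr (W_map C D \<kappa> p q U) (Id (Pt C) S) = Id (Pt D) (FObj (W_map C D \<kappa> p q U) S)"
      unfolding S WA UB WO Id_Pt[of D] CodP[OF f] by (simp add: WO)
  next
    fix a b S S' S''
    assume "a \<in> hom (Pt C) S S'" and "b \<in> hom (Pt C) S' S''"
    moreover obtain f s f' s' f'' s'' where S: "S = (f, s)" "S' = (f', s')" "S'' = (f'', s'')"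
      by (metis surj_pair)
    ultimately have a: "a \<in> hom (Pt C) (f, s) (f', s')" and b: "b \<in> hom (Pt C) (f', s') (f'', s'')"
      by simp_all
    let ?c = "b \<cdot>\<^bsub>Pt C\<^esub> a"
    have c: "?c \<in> hom (Pt C) (f, s) (f'', s'')" using PC.Comp_hom a b by blast
    note A = bs[OF a] and B = bs[OF b]
    have k: "\<kappa> f \<in> hom C (Dom C (\<kappa> f)) (Dom C f)" "\<kappa> f' \<in> hom C (Dom C (\<kappa> f')) (Dom C f')"
      "\<kappa> f'' \<in> hom C (Dom C (\<kappa> f'')) (Dom C f'')"
      using \<kappa> A(2,3) B(3) by (auto simp: kernel_choice_def split_epi_def is_kernel_def)
    have ka: "ker_map C \<kappa> a \<in> hom C (Dom C (\<kappa> f)) (Dom C (\<kappa> f'))"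
      "\<kappa> f' \<cdot>\<^bsub>C\<^esub> ker_map C \<kappa> a = top a \<cdot>\<^bsub>C\<^esub> \<kappa> f"
      using ker_map_unique[OF PC \<kappa> a] by blast+
    have kb: "ker_map C \<kappa> b \<in> hom C (Dom C (\<kappa> f')) (Dom C (\<kappa> f''))"
      "\<kappa> f'' \<cdot>\<^bsub>C\<^esub> ker_map C \<kappa> b = top b \<cdot>\<^bsub>C\<^esub> \<kappa> f'"
      using ker_map_unique[OF PC \<kappa> b] by blast+
    have tops: "top a \<in> hom C (Dom C f) (Dom C f')" "top b \<in> hom C (Dom C f') (Dom C f'')"
      and bases: "base a \<in> hom C (Cod C f) (Cod C f')" "base b \<in> hom C (Cod C f') (Cod C f'')"
      using a b by (auto simp: Pt_hom_iff)
    have cc: "top ?c = top b \<cdot>\<^bsub>C\<^esub> top a" "base ?c = base b \<cdot>\<^bsub>C\<^esub> base a"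
      "src ?c = (f, s)" "tgt ?c = (f'', s'')"
      using A(4) B(5) by (simp_all add: Pt_def)
    have "ker_map C \<kappa> b \<cdot>\<^bsub>C\<^esub> ker_map C \<kappa> a = ker_map C \<kappa> ?c"
      using ker_map_unique[OF PC \<kappa> c, of "ker_map C \<kappa> b \<cdot>\<^bsub>C\<^esub> ker_map C \<kappa> a"]
        C.Comp_hom[OF ka(1) kb(1)] C.assoc[OF ka(1) kb(1) k(3)] C.assoc[OF ka(1) k(2) tops(2)]
        C.assoc[OF k(1) tops] ka(2) kb(2) cc(1) by simp
    then have UK: "FArr U (ker_map C \<kappa> ?c) = FArr U (ker_map C \<kappa> b) \<cdot>\<^bsub>D\<^esub> FArr U (ker_map C \<kappa> a)"
      using FArr_Comp[OF ka(1) kb(1)] by simp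
    have UB: "FArr U (base ?c) = FArr U (base b) \<cdot>\<^bsub>D\<^esub> FArr U (base a)"
      using FArr_Comp[OF bases] cc(2) by simp
    have "t ?c = t b \<cdot>\<^bsub>D\<^esub> t a"
    proof (rule joint[OF B(3) t(1)[OF c]])
      show "t b \<cdot>\<^bsub>D\<^esub> t a \<in> hom D (Dom D (P f)) (Dom D (P f''))"
        using D.Comp_hom t(1)[OF a] t(1)[OF b] by blast
      show "P f'' \<cdot>\<^bsub>D\<^esub> t ?c = P f'' \<cdot>\<^bsub>D\<^esub> (t b \<cdot>\<^bsub>D\<^esub> t a)"
        using t(2)[OF c] UB t(2)[OF a] t(2)[OF b]
          D.assoc[OF t(1)[OF a] t(1)[OF b] PQ(1)[OF B(3)]]
          D.assoc[OF t(1)[OF a] PQ(1)[OF B(2)] B(1)]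
          D.assoc[OF PQ(1)[OF A(2)] A(1) B(1)] by simp
      show "Q f'' \<cdot>\<^bsub>D\<^esub> t ?c = Q f'' \<cdot>\<^bsub>D\<^esub> (t b \<cdot>\<^bsub>D\<^esub> t a)"
        using t(3)[OF c] UK t(3)[OF a] t(3)[OF b]
          D.assoc[OF t(1)[OF a] t(1)[OF b] PQ(2)[OF B(3)]]
          D.assoc[OF t(1)[OF a] PQ(2)[OF B(2)] km[OF b]]
          D.assoc[OF PQ(2)[OF A(2)] km[OF a] km[OF b]] by simp
    qed
    then show "FArr (W_map C D \<kappa> p q U) ?c =
        FArr (W_map C D \<kappa> p q U) b \<cdot>\<^bsub>Pt D\<^esub> FArr (W_map C D \<kappa> p q U) a"
      by (simp add: WA UB cc(3,4) A(4) B(5))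
  qed
qed

end

(* Kernels turn pullbacks of split epimorphisms into isomorphisms. Given a rectangle of split
   epimorphisms whose left square and whole are pullbacks, the right square b therefore induces an
   isomorphism of kernels, and so does the comparison w from the left edge of b to the pullback of
   the right edge of b along its base. Since W_U only sees codomains and kernels, W_U(w) is
   invertible; the semi-direct index transports this to U(w), and w is invertible because U is
   conservative. So b is itself a pullback. *)
theory Submission
  imports Defs
begin

section \<open>Isomorphisms, products and pullback squares in a category\<close>

context category
begin

lemma iso_iff_inverse:
  assumes "f \<in> hom C X Y"
  shows "iso C f \<longleftrightarrow> (\<exists>g \<in> hom C Y X. g \<cdot> f = Id C X \<and> f \<cdot> g = Id C Y)"
  using assms by (auto simp: iso_def hom_def)

lemma iso_Comp:
  assumes f: "f \<in> hom C X Y" and g: "g \<in> hom C Y Z" and "iso C f" "iso C g"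
  shows "iso C (g \<cdot> f)"
proof -
  obtain f' where f': "f' \<in> hom C Y X" "f' \<cdot> f = Id C X" "f \<cdot> f' = Id C Y"
    using assms(3) iso_iff_inverse[OF f] by blast
  obtain g' where g': "g' \<in> hom C Z Y" "g' \<cdot> g = Id C Y" "g \<cdot> g' = Id C Z"
    using assms(4) iso_iff_inverse[OF g] by blast
  have "f' \<cdot> g' \<cdot> (g \<cdot> f) = Id C X"
    using assoc[OF Comp_hom[OF f g] g'(1) f'(1)] assoc[OF f g g'(1)] g'(2) f'(2) Id_left[OF f] by simp
  moreover have "g \<cdot> f \<cdot> (f' \<cdot> g') = Id C Z"
    using assoc[OF Comp_hom[OF g'(1) f'(1)] f g] assoc[OF g'(1) f'(1) f] g'(3) f'(3)
      Id_left[OF g'(1)] by simp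
  ultimately show ?thesis
    using iso_iff_inverse[OF Comp_hom[OF f g]] Comp_hom[OF g'(1) f'(1)] by blast
qed

lemma iso_inverse:
  assumes "f \<in> hom C X Y" "iso C f"
  obtains g where "g \<in> hom C Y X" "g \<cdot> f = Id C X" "f \<cdot> g = Id C Y" "iso C g"
proof -
  obtain g where g: "g \<in> hom C Y X" "g \<cdot> f = Id C X" "f \<cdot> g = Id C Y"
    using assms iso_iff_inverse[OF assms(1)] by blast
  then have "iso C g" using iso_iff_inverse[OF g(1)] assms(1) by blast
  with g show ?thesis by (rule that)
qed

lemma iso_cancel_left:
  assumes f: "f \<in> hom C X Y" and g: "g \<in> hom C Y Z" and "iso C g" "iso C (g \<cdot> f)"
  shows "iso C f"
proof -
  obtain g' where g': "g' \<in> hom C Z Y" "g' \<cdot> g = Id C Y" "iso C g'"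
    using iso_inverse[OF g assms(3)] by metis
  have "g' \<cdot> (g \<cdot> f) = f" using assoc[OF f g g'(1)] g'(2) Id_left[OF f] by simp
  then show ?thesis using iso_Comp[OF Comp_hom[OF f g] g'(1) assms(4) g'(3)] by simp
qed

lemma iso_cancel_right:
  assumes f: "f \<in> hom C X Y" and g: "g \<in> hom C Y Z" and "iso C f" "iso C (g \<cdot> f)"
  shows "iso C g"
proof -
  obtain f' where f': "f' \<in> hom C Y X" "f \<cdot> f' = Id C Y" "iso C f'"
    using iso_inverse[OF f assms(3)] by metis
  have "g \<cdot> f \<cdot> f' = g" using assoc[OF f'(1) f g] f'(2) Id_right[OF g] by simp
  then show ?thesis using iso_Comp[OF f'(1) Comp_hom[OF f g] f'(3) assms(4)] by simp
qed

text \<open>The inverses of \<open>u\<close> and \<open>v\<close> induce an arrow back between the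
  products. Both composites with \<open>h\<close> have the projections of an identity, and the
  projections of a product are jointly monic.\<close>

lemma iso_product_map:
  assumes P: "is_product C A B p q" and P': "is_product C A' B' p' q'"
    and u: "u \<in> hom C A A'" "iso C u" and v: "v \<in> hom C B B'" "iso C v"
    and h: "h \<in> hom C (Dom C p) (Dom C p')" "p' \<cdot> h = u \<cdot> p" "q' \<cdot> h = v \<cdot> q"
  shows "iso C h"
proof -
  note pq = P[unfolded is_product_def, THEN conjunct1]
    P[unfolded is_product_def, THEN conjunct2, THEN conjunct1]
  note pq' = P'[unfolded is_product_def, THEN conjunct1]
    P'[unfolded is_product_def, THEN conjunct2, THEN conjunct1]
  \<comment> \<open>Stated for an arbitrary product, since it is applied to \<open>P\<close> for one
    composite and to \<open>P'\<close> for the other.\<close>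
  have joint: "a = b" if "is_product C A0 B0 p0 q0" "a \<in> hom C T (Dom C p0)"
    "b \<in> hom C T (Dom C p0)" "p0 \<cdot> a = p0 \<cdot> b" "q0 \<cdot> a = q0 \<cdot> b" for A0 B0 p0 q0 T a b
  proof -
    have "p0 \<cdot> b \<in> hom C T A0" "q0 \<cdot> b \<in> hom C T B0"
      using that(1,3) Comp_hom unfolding is_product_def by blast+
    then have "\<exists>!w. w \<in> hom C T (Dom C p0) \<and> p0 \<cdot> w = p0 \<cdot> b \<and> q0 \<cdot> w = q0 \<cdot> b"
      using that(1) unfolding is_product_def by blast
    then show ?thesis using that(2-5) by blast
  qed
  obtain u' where u': "u' \<in> hom C A' A" "u' \<cdot> u = Id C A" "u \<cdot> u' = Id C A'"
    using u iso_iff_inverse by blast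
  obtain v' where v': "v' \<in> hom C B' B" "v' \<cdot> v = Id C B" "v \<cdot> v' = Id C B'"
    using v iso_iff_inverse by blast
  obtain h' where h': "h' \<in> hom C (Dom C p') (Dom C p)" "p \<cdot> h' = u' \<cdot> p'" "q \<cdot> h' = v' \<cdot> q'"
    using P Comp_hom[OF pq'(1) u'(1)] Comp_hom[OF pq'(2) v'(1)] unfolding is_product_def by blast
  have "h' \<cdot> h = Id C (Dom C p)"
  proof (rule joint[OF P Comp_hom[OF h(1) h'(1)]])
    show "p \<cdot> (h' \<cdot> h) = p \<cdot> Id C (Dom C p)"
      using assoc[OF h(1) h'(1) pq(1)] assoc[OF h(1) pq'(1) u'(1)] assoc[OF pq(1) u(1) u'(1)]
        h h' u' Id_left[OF pq(1)] Id_right[OF pq(1)] by simp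
    show "q \<cdot> (h' \<cdot> h) = q \<cdot> Id C (Dom C p)"
      using assoc[OF h(1) h'(1) pq(2)] assoc[OF h(1) pq'(2) v'(1)] assoc[OF pq(2) v(1) v'(1)]
        h h' v' Id_left[OF pq(2)] Id_right[OF pq(2)] by simp
  qed (use Id_hom hom_Obj pq in blast)
  moreover have "h \<cdot> h' = Id C (Dom C p')"
  proof (rule joint[OF P' Comp_hom[OF h'(1) h(1)]])
    show "p' \<cdot> (h \<cdot> h') = p' \<cdot> Id C (Dom C p')"
      using assoc[OF h'(1) h(1) pq'(1)] assoc[OF h'(1) pq(1) u(1)] assoc[OF pq'(1) u'(1) u(1)]
        h h' u' Id_left[OF pq'(1)] Id_right[OF pq'(1)] by simp
    show "q' \<cdot> (h \<cdot> h') = q' \<cdot> Id C (Dom C p')"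
      using assoc[OF h'(1) h(1) pq'(2)] assoc[OF h'(1) pq(2) v(1)] assoc[OF pq'(2) v'(1) v(1)]
        h h' v' Id_left[OF pq'(2)] Id_right[OF pq'(2)] by simp
  qed (use Id_hom hom_Obj pq' in blast)
  ultimately show ?thesis using iso_iff_inverse[OF h(1)] h'(1) by blast
qed

text \<open>The definition types \<open>p\<close> on \<open>Dom C q\<close> and \<open>q\<close> on
  \<open>Dom C p\<close>. The typing of \<open>p\<close> forces these two objects to agree, so
  \<open>Dom C p\<close> serves as the single apex from here on.\<close>

lemma pullback_squareD:
  assumes "pullback_square C p q f g"
  shows "p \<in> hom C (Dom C p) (Dom C f)" and "q \<in> hom C (Dom C p) (Dom C g)"
    and "f \<in> hom C (Dom C f) (Cod C f)" and "g \<in> hom C (Dom C g) (Cod C f)"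
    and "f \<cdot> p = g \<cdot> q"
proof -
  have h: "p \<in> hom C (Dom C q) (Dom C f)" "q \<in> hom C (Dom C p) (Dom C g)" "f \<in> Arr C"
    "g \<in> hom C (Dom C g) (Cod C f)" "f \<cdot> p = g \<cdot> q"
    using assms unfolding pullback_square_def by blast+
  from h(1) show "p \<in> hom C (Dom C p) (Dom C f)" by (simp add: hom_def)
  show "f \<in> hom C (Dom C f) (Cod C f)" by (rule Arr_hom[OF h(3)])
qed (use assms in \<open>auto simp only: pullback_square_def\<close>)

lemma pullback_square_joint_monic:
  assumes P: "pullback_square C p q f g"
    and a: "a \<in> hom C T (Dom C p)" and b: "b \<in> hom C T (Dom C p)"
    and eq: "p \<cdot> a = p \<cdot> b" "q \<cdot> a = q \<cdot> b"
  shows "a = b"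
proof -
  note h = pullback_squareD[OF P]
  then have "f \<cdot> (p \<cdot> b) = g \<cdot> (q \<cdot> b)"
    using assoc[OF b h(1,3)] assoc[OF b h(2,4)] by simp
  then have "\<exists>!u. u \<in> hom C T (Dom C p) \<and> p \<cdot> u = p \<cdot> b \<and> q \<cdot> u = q \<cdot> b"
    using P Comp_hom[OF b h(1)] Comp_hom[OF b h(2)] unfolding pullback_square_def by blast
  then show ?thesis using a b eq by blast
qed

text \<open>Arrows into \<open>X\<close> correspond to arrows into the old apex by composing with
  \<open>w\<close> and with its inverse, so the universal property moves to \<open>X\<close>. This
  turns an invertible comparison arrow into a pullback square.\<close>

lemma pullback_square_Comp_iso:
  assumes P: "pullback_square C p q f g" and w: "w \<in> hom C X (Dom C p)" "iso C w"
  shows "pullback_square C (p \<cdot> w) (q \<cdot> w) f g"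
proof -
  note h = pullback_squareD[OF P]
  obtain v where v: "v \<in> hom C (Dom C p) X" "v \<cdot> w = Id C X" "w \<cdot> v = Id C (Dom C p)"
    using w iso_iff_inverse by blast
  have pw: "p \<cdot> w \<in> hom C X (Dom C f)" and qw: "q \<cdot> w \<in> hom C X (Dom C g)"
    using Comp_hom w h by blast+
  then have d: "Dom C (p \<cdot> w) = X" "Dom C (q \<cdot> w) = X" by (simp_all add: hom_def)
  have ex1: "\<exists>!u. u \<in> hom C T X \<and> p \<cdot> w \<cdot> u = a \<and> q \<cdot> w \<cdot> u = b"
    if ab: "a \<in> hom C T (Dom C f)" "b \<in> hom C T (Dom C g)" "f \<cdot> a = g \<cdot> b" for T a b
  proof -
    obtain u where u: "u \<in> hom C T (Dom C p)" "p \<cdot> u = a" "q \<cdot> u = b"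
      using P ab unfolding pullback_square_def by blast
    have vu: "v \<cdot> u \<in> hom C T X" using Comp_hom u v by blast
    have wvu: "w \<cdot> (v \<cdot> u) = u" using assoc[OF u(1) v(1) w(1)] v(3) Id_left[OF u(1)] by simp
    show ?thesis
    proof (rule ex1I[of _ "v \<cdot> u"])
      show "v \<cdot> u \<in> hom C T X \<and> p \<cdot> w \<cdot> (v \<cdot> u) = a \<and> q \<cdot> w \<cdot> (v \<cdot> u) = b"
        using vu wvu u assoc[OF vu w(1) h(1)] assoc[OF vu w(1) h(2)] by simp
    next
      fix z assume z: "z \<in> hom C T X \<and> p \<cdot> w \<cdot> z = a \<and> q \<cdot> w \<cdot> z = b"
      \<comment> \<open>A competing factorisation \<open>z\<close> becomes, after \<open>w\<close>,
        a factorisation through the given pullback; the inverse \<open>v\<close> then recovers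
        \<open>z\<close>.\<close>
      have "w \<cdot> z = u"
        using pullback_square_joint_monic[OF P Comp_hom[OF _ w(1)] u(1)] z u
          assoc[OF _ w(1) h(1)] assoc[OF _ w(1) h(2)] by metis
      then show "z = v \<cdot> u" using assoc[OF _ w(1) v(1)] v(2) z Id_left by metis
    qed
  qed
  show ?thesis
    unfolding pullback_square_def d
  proof (intro conjI allI impI)
    show "f \<in> Arr C" using h(3) by (simp add: hom_def)
    show "f \<cdot> (p \<cdot> w) = g \<cdot> (q \<cdot> w)"
      using assoc[OF w(1) h(1,3)] assoc[OF w(1) h(2,4)] h(5) by simp
  qed (use pw qw h(4) ex1 in blast)+
qed

end

section \<open>Pullbacks from finite limits\<close>

text \<open>The shape 0 -> 2 <- 1: the arrows 0, 1, 2 are the identities, 3 goes from 0 to 2 and 4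
  from 1 to 2. Two non-identity arrows are never composable, so a composite is \<open>a\<close> when
  \<open>b\<close> is an identity and \<open>b\<close> otherwise. Natural numbers are used because
  \<open>finitely_complete\<close> ranges over shapes of that type.\<close>

definition cospan_shape :: "(nat, nat) cat" where
  "cospan_shape =
     \<lparr>Obj = {0, 1, 2}, Arr = {0, 1, 2, 3, 4},
      Dom = (\<lambda>a. if a = 3 then 0 else if a = 4 then 1 else a),
      Cod = (\<lambda>a. if a = 3 \<or> a = 4 then 2 else a),
      Id = (\<lambda>j. j),
      Comp = (\<lambda>b a. if b \<le> 2 then a else b)\<rparr>"

lemma finite_category_cospan_shape: "finite_category cospan_shape"
  unfolding finite_category_def
proof
  show "category cospan_shape"
    by unfold_locales (auto simp: cospan_shape_def hom_def split: if_splits)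
qed (simp add: cospan_shape_def)

lemma finitely_complete_pullback:
  fixes C (structure)
  assumes fc: "finitely_complete C" and f: "f \<in> hom C A B" and g: "g \<in> hom C A' B"
  obtains p q where "pullback_square C p q f g"
proof -
  interpret category C using fc by (simp add: finitely_complete_def)
  have d: "Dom C f = A" "Cod C f = B" "Dom C g = A'" "Cod C g = B" "f \<in> Arr C" "g \<in> Arr C"
    using f g by (auto simp: hom_def)
  have ob: "A \<in> Obj C" "A' \<in> Obj C" "B \<in> Obj C" using hom_Obj f g by auto
  let ?J = cospan_shape
  define F where "F = \<lparr>FObj = (\<lambda>j::nat. if j = 0 then A else if j = 1 then A' else B),
    FArr = (\<lambda>a::nat. if a = 0 then Id C A else if a = 1 then Id C A'
      else if a = 2 then Id C B else if a = 3 then f else g)\<rparr>"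
  interpret J: category ?J using finite_category_cospan_shape by (simp add: finite_category_def)
  have "cat_functor ?J C F"
  proof unfold_locales
    fix X Y Z a b assume "a \<in> hom ?J X Y" "b \<in> hom ?J Y Z"
    then show "FArr F (Comp ?J b a) = FArr F b \<cdot> FArr F a"
      using f g ob
      by (auto simp: cospan_shape_def hom_def F_def Id_left[OF f] Id_left[OF g]
          Id_right[OF f] Id_right[OF g] Id_left[OF Id_hom] split: if_splits)
  next
    fix X Y a assume "a \<in> hom ?J X Y"
    then show "FArr F a \<in> hom C (FObj F X) (FObj F Y)"
      using f g Id_hom ob by (auto simp: cospan_shape_def hom_def F_def split: if_splits)
  qed (use ob in \<open>auto simp: cospan_shape_def F_def\<close>)
  then obtain L \<pi> where L: "limit_cone ?J C F L \<pi>"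
    using fc finite_category_cospan_shape unfolding finitely_complete_def by blast
  \<comment> \<open>The conditions at the three identity arrows hold by \<open>Id_left\<close>; only
    those at the arrows 3 and 4 remain.\<close>
  have cone_iff: "cone ?J C F T \<sigma> \<longleftrightarrow> T \<in> Obj C \<and> \<sigma> 0 \<in> hom C T A \<and> \<sigma> 1 \<in> hom C T A' \<and>
      \<sigma> 2 \<in> hom C T B \<and> f \<cdot> \<sigma> 0 = \<sigma> 2 \<and> g \<cdot> \<sigma> 1 = \<sigma> 2" for T \<sigma>
    unfolding cone_def cospan_shape_def F_def by (auto simp: Id_left)
  have \<pi>: "\<pi> 0 \<in> hom C L A" "\<pi> 1 \<in> hom C L A'" "f \<cdot> \<pi> 0 = \<pi> 2" "g \<cdot> \<pi> 1 = \<pi> 2"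
    using L unfolding limit_cone_def cone_iff by auto
  have "\<exists>!u. u \<in> hom C T L \<and> \<pi> 0 \<cdot> u = a \<and> \<pi> 1 \<cdot> u = b"
    if ab: "a \<in> hom C T A" "b \<in> hom C T A'" "f \<cdot> a = g \<cdot> b" for T a b
  proof -
    \<comment> \<open>The leg at the vertex 2 is forced to be the common composite.\<close>
    define \<sigma> where "\<sigma> = (\<lambda>j::nat. if j = 0 then a else if j = 1 then b else f \<cdot> a)"
    have "cone ?J C F T \<sigma>"
      using ab hom_Obj[OF ab(1)] Comp_hom[OF ab(1) f] by (simp add: cone_iff \<sigma>_def)
    then have "\<exists>!u. u \<in> hom C T L \<and> (\<forall>j \<in> Obj ?J. \<pi> j \<cdot> u = \<sigma> j)"
      using L unfolding limit_cone_def by blast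
    \<comment> \<open>Compatibility with the leg at 2 follows from compatibility with the leg at 0,
      as \<open>\<pi> 2\<close> is \<open>f \<cdot> \<pi> 0\<close>.\<close>
    moreover have "(\<forall>j \<in> Obj ?J. \<pi> j \<cdot> u = \<sigma> j) \<longleftrightarrow> \<pi> 0 \<cdot> u = a \<and> \<pi> 1 \<cdot> u = b"
      if "u \<in> hom C T L" for u
      using assoc[OF that \<pi>(1) f] \<pi>(3) by (auto simp: cospan_shape_def \<sigma>_def)
    ultimately show ?thesis by (metis (no_types, lifting))
  qed
  then have "pullback_square C (\<pi> 0) (\<pi> 1) f g"
    using \<pi> f g d unfolding pullback_square_def by (auto simp: hom_def)
  then show ?thesis by (rule that)
qed

section \<open>Induced arrows between kernels\<close>

lemma ker_map_Comp:
  fixes C (structure)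
  assumes PC: "pointed C" and \<kappa>: "kernel_choice C \<kappa>"
    and a: "a \<in> hom (Pt C) P Q" and b: "b \<in> hom (Pt C) Q R"
  shows "ker_map C \<kappa> (b \<cdot>\<^bsub>Pt C\<^esub> a) = ker_map C \<kappa> b \<cdot> ker_map C \<kappa> a"
proof -
  interpret category C using PC by (simp add: pointed_def)
  interpret PC: category "Pt C" by (rule category_Pt)
  obtain f s f' s' f'' s'' where S: "P = (f, s)" "Q = (f', s')" "R = (f'', s'')"
    by (metis surj_pair)
  note a' = a[unfolded S] and b' = b[unfolded S]
  have c: "b \<cdot>\<^bsub>Pt C\<^esub> a \<in> hom (Pt C) (f, s) (f'', s'')"
    using PC.Comp_hom a' b' by blast
  have k: "\<kappa> f \<in> hom C (Dom C (\<kappa> f)) (Dom C f)" "\<kappa> f' \<in> hom C (Dom C (\<kappa> f')) (Dom C f')"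
    "\<kappa> f'' \<in> hom C (Dom C (\<kappa> f'')) (Dom C f'')"
    using \<kappa> a' b' by (auto simp: Pt_hom_iff kernel_choice_def split_epi_def is_kernel_def)
  have t: "top a \<in> hom C (Dom C f) (Dom C f')" "top b \<in> hom C (Dom C f') (Dom C f'')"
    using a' b' by (auto simp: Pt_hom_iff)
  have ka: "ker_map C \<kappa> a \<in> hom C (Dom C (\<kappa> f)) (Dom C (\<kappa> f'))"
    "\<kappa> f' \<cdot> ker_map C \<kappa> a = top a \<cdot> \<kappa> f"
    using ker_map_unique[OF PC \<kappa> a'] by blast+
  have kb: "ker_map C \<kappa> b \<in> hom C (Dom C (\<kappa> f')) (Dom C (\<kappa> f''))"
    "\<kappa> f'' \<cdot> ker_map C \<kappa> b = top b \<cdot> \<kappa> f'"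
    using ker_map_unique[OF PC \<kappa> b'] by blast+
  have "top (b \<cdot>\<^bsub>Pt C\<^esub> a) = top b \<cdot> top a" by (simp add: Pt_def)
  \<comment> \<open>The composite of the two kernel arrows solves the factorisation problem whose
    unique solution is \<open>ker_map\<close> of the composite morphism.\<close>
  then show ?thesis
    using ker_map_unique[OF PC \<kappa> c, of "ker_map C \<kappa> b \<cdot> ker_map C \<kappa> a"]
      Comp_hom[OF ka(1) kb(1)] assoc[OF ka(1) kb(1) k(3)] assoc[OF ka(1) k(2) t(2)]
      assoc[OF k(1) t] ka(2) kb(2) by simp
qed

text \<open>The kernel of \<open>f'\<close>, paired with a zero arrow into \<open>Cod C f\<close>,
  lifts through the pullback to an arrow killed by \<open>f\<close>. This lift factors through the
  kernel of \<open>f\<close>, and the factor is the inverse sought.\<close>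

lemma iso_ker_map_pt_pullback:
  assumes PC: "pointed C" and \<kappa>: "kernel_choice C \<kappa>"
    and a: "a \<in> hom (Pt C) P Q" and pb: "pt_pullback C a"
  shows "iso C (ker_map C \<kappa> a)"
proof -
  interpret category C using PC by (simp add: pointed_def)
  obtain f s f' s' where S: "P = (f, s)" "Q = (f', s')" by (metis surj_pair)
  note a' = a[unfolded S]
  obtain x y where A: "a = PtArr (f, s) (f', s') x y" "split_epi C f s" "split_epi C f' s'"
    "x \<in> hom C (Dom C f) (Dom C f')" "y \<in> hom C (Cod C f) (Cod C f')" "f' \<cdot>\<^bsub>C\<^esub> x = y \<cdot>\<^bsub>C\<^esub> f"
    using a' unfolding Pt_hom_iff by blast
  have f: "f \<in> hom C (Dom C f) (Cod C f)"
    using split_epi_hom[OF A(2)] by blast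
  have PB: "pullback_square C x f f' y" using pb A(1) by (simp add: pt_pullback_def)
  have xy: "Dom C x = Dom C f" "Dom C y = Cod C f" using A(4,5) by (simp_all add: hom_def)
  have K: "is_kernel C f (\<kappa> f)" and K': "is_kernel C f' (\<kappa> f')"
    using \<kappa> A(2,3) by (auto simp: kernel_choice_def split_epi_def)
  let ?k = "\<kappa> f" and ?k' = "\<kappa> f'"
  have k: "?k \<in> hom C (Dom C ?k) (Dom C f)" "f \<cdot>\<^bsub>C\<^esub> ?k = zero_arrow C (Dom C ?k) (Cod C f)"
    using K by (auto simp: is_kernel_def)
  have k': "?k' \<in> hom C (Dom C ?k') (Dom C f')"
    "f' \<cdot>\<^bsub>C\<^esub> ?k' = zero_arrow C (Dom C ?k') (Cod C f')"
    using K' by (auto simp: is_kernel_def)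
  have ob: "Dom C ?k' \<in> Obj C" "Cod C f \<in> Obj C" "Dom C ?k \<in> Obj C"
    using hom_Obj k' f k by auto
  let ?m = "ker_map C \<kappa> a"
  have m: "?m \<in> hom C (Dom C ?k) (Dom C ?k')" "?k' \<cdot>\<^bsub>C\<^esub> ?m = x \<cdot>\<^bsub>C\<^esub> ?k"
    using ker_map_unique[OF PC \<kappa> a', of ?m] A(1) by auto
  let ?z = "zero_arrow C (Dom C ?k') (Cod C f)"
  \<comment> \<open>Both sides are zero arrows, so \<open>?k'\<close> and \<open>?z\<close> form a
    cone over \<open>f'\<close> and \<open>y\<close>; its lift \<open>v\<close> satisfies
    \<open>f v = 0\<close>.\<close>
  have "f' \<cdot>\<^bsub>C\<^esub> ?k' = y \<cdot>\<^bsub>C\<^esub> ?z"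
    using k'(2) zero_arrow_Comp_left[OF PC A(5) ob(1)] by simp
  then obtain v where v: "v \<in> hom C (Dom C ?k') (Dom C f)" "x \<cdot>\<^bsub>C\<^esub> v = ?k'" "f \<cdot>\<^bsub>C\<^esub> v = ?z"
    using PB k'(1) zero_arrow_hom[OF PC ob(1,2)] unfolding pullback_square_def xy by blast
  then obtain n where n: "n \<in> hom C (Dom C ?k') (Dom C ?k)" "?k \<cdot>\<^bsub>C\<^esub> n = v"
    using K unfolding is_kernel_def by blast
  \<comment> \<open>\<open>?k'\<close> factors through itself uniquely, so \<open>?m\<close> after
    \<open>n\<close> must be the identity.\<close>
  have "\<exists>!u. u \<in> hom C (Dom C ?k') (Dom C ?k') \<and> ?k' \<cdot>\<^bsub>C\<^esub> u = ?k'"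
    using K' k' unfolding is_kernel_def by blast
  moreover have "?k' \<cdot>\<^bsub>C\<^esub> (?m \<cdot>\<^bsub>C\<^esub> n) = ?k'"
    using assoc[OF n(1) m(1) k'(1)] assoc[OF n(1) k(1) A(4)] m(2) n(2) v(2) by simp
  ultimately have mn: "?m \<cdot>\<^bsub>C\<^esub> n = Id C (Dom C ?k')"
    using Comp_hom[OF n(1) m(1)] Id_hom[OF ob(1)] Id_right[OF k'(1)] by blast
  \<comment> \<open>The two arrows have the same projections: \<open>x\<close> sends both to
    \<open>x\<close> after \<open>?k\<close>, and \<open>f\<close> sends both to zero.\<close>
  have vm: "v \<cdot>\<^bsub>C\<^esub> ?m = ?k"
  proof (rule pullback_square_joint_monic[OF PB, unfolded xy])
    show "v \<cdot>\<^bsub>C\<^esub> ?m \<in> hom C (Dom C ?k) (Dom C f)" by (rule Comp_hom[OF m(1) v(1)])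
    show "x \<cdot>\<^bsub>C\<^esub> (v \<cdot>\<^bsub>C\<^esub> ?m) = x \<cdot>\<^bsub>C\<^esub> ?k"
      using assoc[OF m(1) v(1) A(4)] v(2) m(2) by simp
    show "f \<cdot>\<^bsub>C\<^esub> (v \<cdot>\<^bsub>C\<^esub> ?m) = f \<cdot>\<^bsub>C\<^esub> ?k"
      using assoc[OF m(1) v(1) f] v(3) k(2) zero_arrow_Comp_right[OF PC m(1) ob(2)] by simp
  qed (rule k(1))
  have "\<exists>!u. u \<in> hom C (Dom C ?k) (Dom C ?k) \<and> ?k \<cdot>\<^bsub>C\<^esub> u = ?k"
    using K k unfolding is_kernel_def by blast
  moreover have "?k \<cdot>\<^bsub>C\<^esub> (n \<cdot>\<^bsub>C\<^esub> ?m) = ?k"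
    using assoc[OF m(1) n(1) k(1)] n(2) vm by simp
  ultimately have "n \<cdot>\<^bsub>C\<^esub> ?m = Id C (Dom C ?k)"
    using Comp_hom[OF m(1) n(1)] Id_hom[OF ob(3)] Id_right[OF k(1)] by blast
  with mn n(1) show ?thesis using iso_iff_inverse[OF m(1)] by blast
qed

section \<open>Transporting invertibility through the semi-direct index\<close>

lemma (in cat_functor) iso_FArr:
  assumes "f \<in> hom C X Y" "iso C f"
  shows "iso D (FArr F f)"
proof -
  obtain g where g: "g \<in> hom C Y X" "g \<cdot>\<^bsub>C\<^esub> f = Id C X" "f \<cdot>\<^bsub>C\<^esub> g = Id C Y"
    using assms C.iso_iff_inverse by blast
  have "FArr F g \<cdot>\<^bsub>D\<^esub> FArr F f = Id D (FObj F X)" "FArr F f \<cdot>\<^bsub>D\<^esub> FArr F g = Id D (FObj F Y)"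
    using FArr_Comp[OF assms(1) g(1)] FArr_Comp[OF g(1) assms(1)] g FArr_Id C.hom_Obj[OF g(1)]
    by simp_all
  then show ?thesis
    using D.iso_iff_inverse[OF FArr_hom[OF assms(1)]] FArr_hom[OF g(1)] by blast
qed

lemma (in category) iso_top_Pt:
  assumes a: "a \<in> hom (Pt C) (f, s) (f', s')" and "iso (Pt C) a"
  shows "iso C (top a)"
proof -
  interpret PC: category "Pt C" by (rule category_Pt)
  obtain b where b: "b \<in> hom (Pt C) (f', s') (f, s)" "b \<cdot>\<^bsub>Pt C\<^esub> a = Id (Pt C) (f, s)"
    "a \<cdot>\<^bsub>Pt C\<^esub> b = Id (Pt C) (f', s')"
    using assms PC.iso_iff_inverse by blast
  have "top a \<in> hom C (Dom C f) (Dom C f')" "top b \<in> hom C (Dom C f') (Dom C f)"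
    "top b \<cdot> top a = Id C (Dom C f)" "top a \<cdot> top b = Id C (Dom C f')"
    using a b by (auto simp: Pt_hom_iff)
  then show ?thesis using iso_iff_inverse by blast
qed

text \<open>The top arrow is the product of \<open>FArr U (base w)\<close> and
  \<open>FArr U (ker_map C \<kappa> w)\<close>, and functors preserve isomorphisms.\<close>

lemma iso_top_W_arr:
  assumes U: "cat_functor C D U" and PC: "pointed C"
    and \<kappa>: "kernel_choice C \<kappa>" and pq: "product_choice D p q"
    and w: "w \<in> hom (Pt C) P Q" and bw: "iso C (base w)" and kw: "iso C (ker_map C \<kappa> w)"
  shows "iso D (top (W_arr C D \<kappa> p q U w))"
proof -
  interpret cat_functor C D U by fact
  obtain f s f' s' where S: "P = (f, s)" "Q = (f', s')" by (metis surj_pair)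
  note w' = w[unfolded S]
  have sf: "src w = (f, s)" "tgt w = (f', s')"
    and y: "base w \<in> hom C (Cod C f) (Cod C f')"
    using w' by (auto simp: Pt_hom_iff)
  have k: "ker_map C \<kappa> w \<in> hom C (Dom C (\<kappa> f)) (Dom C (\<kappa> f'))"
    using ker_map_unique[OF PC \<kappa> w'] by blast
  define Y K Y' K' where YK: "Y = FObj U (Cod C f)" "K = FObj U (Dom C (\<kappa> f))"
    "Y' = FObj U (Cod C f')" "K' = FObj U (Dom C (\<kappa> f'))"
  have Uy: "FArr U (base w) \<in> hom D Y Y'" and Uk: "FArr U (ker_map C \<kappa> w) \<in> hom D K K'"
    using y k FArr_hom unfolding YK by blast+
  have ob: "Y \<in> Obj D" "K \<in> Obj D" "Y' \<in> Obj D" "K' \<in> Obj D"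
    using D.hom_Obj Uy Uk by auto
  have pr: "is_product D Y K (p Y K) (q Y K)" "is_product D Y' K' (p Y' K') (q Y' K')"
    using pq ob unfolding product_choice_def by auto
  then have pqh: "p Y K \<in> hom D (Dom D (p Y K)) Y" "q Y K \<in> hom D (Dom D (p Y K)) K"
    unfolding is_product_def by auto
  have t: "top (W_arr C D \<kappa> p q U w) =
      pairing D p q Y' K' (FArr U (base w) \<cdot>\<^bsub>D\<^esub> p Y K) (FArr U (ker_map C \<kappa> w) \<cdot>\<^bsub>D\<^esub> q Y K)"
    by (simp add: W_arr_def sf YK Let_def)
  show ?thesis
    using pairing_unique[OF pq ob(3,4) D.Comp_hom[OF pqh(1) Uy] D.Comp_hom[OF pqh(2) Uk]]
      D.iso_product_map[OF pr Uy iso_FArr[OF y bw] Uk iso_FArr[OF k kw]]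
    unfolding t by blast
qed

text \<open>A form of the split short five lemma. In the naturality square of \<open>\<rho>\<close>
  at \<open>w\<close>, the components of \<open>\<rho>\<close> and the arrow given by
  \<open>W_map\<close> have invertible tops, hence so does the remaining side
  \<open>FArr U (top w)\<close>; conservativity reflects this to \<open>top w\<close>.\<close>

lemma semi_direct_index_iso_top:
  assumes PC: "pointed C" and \<kappa>: "kernel_choice C \<kappa>" and pq: "product_choice D p q"
    and \<rho>: "semi_direct_index C D \<kappa> p q U \<rho>" and cons: "conservative C D U"
    and w: "w \<in> hom (Pt C) P Q" and bw: "iso C (base w)" and kw: "iso C (ker_map C \<kappa> w)"
  shows "iso C (top w)"
proof -
  have U: "cat_functor C D U" using cons by (simp add: conservative_def)
  interpret cat_functor C D U by (fact U)
  interpret N: natural_iso "Pt C" "Pt D" "Pt_map U" "W_map C D \<kappa> p q U" \<rho>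
    using \<rho> by (simp add: semi_direct_index_def)
  have PQ: "P \<in> Obj (Pt C)" "Q \<in> Obj (Pt C)" using N.F.C.hom_Obj[OF w] by auto
  obtain f s f' s' where S: "P = (f, s)" "Q = (f', s')" by (metis surj_pair)
  have tw: "top w \<in> hom C (Dom C f) (Dom C f')"
    using w unfolding S by (auto simp: Pt_hom_iff)
  let ?W = "FArr (W_map C D \<kappa> p q U) w" and ?PU = "FArr (Pt_map U) w"
  have iso_top: "iso D (top (\<rho> R))" if "R \<in> Obj (Pt C)" for R
    using D.iso_top_Pt N.component_hom[OF that] N.component_iso[OF that] by (metis surj_pair)
  have top_hom: "top a \<in> hom D (Dom D (fst R)) (Dom D (fst R'))"
    if "a \<in> hom (Pt D) R R'" for a R R'
    using that by (cases R; cases R') (auto simp: Pt_hom_iff)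
  note h = top_hom[OF N.component_hom[OF PQ(1)]] top_hom[OF N.component_hom[OF PQ(2)]]
    top_hom[OF N.F.FArr_hom[OF w]] top_hom[OF N.G.FArr_hom[OF w]]
  have "top (?W \<cdot>\<^bsub>Pt D\<^esub> \<rho> P) = top (\<rho> Q \<cdot>\<^bsub>Pt D\<^esub> ?PU)"
    using N.naturality[OF w] by simp
  \<comment> \<open>Composition in \<open>Pt D\<close> is componentwise, so the naturality square
    restricts to the top arrows.\<close>
  then have nat: "top ?W \<cdot>\<^bsub>D\<^esub> top (\<rho> P) = top (\<rho> Q) \<cdot>\<^bsub>D\<^esub> top ?PU"
    by (simp add: Pt_def)
  have "iso D (top ?W)"
    using iso_top_W_arr[OF U PC \<kappa> pq w bw kw] by (simp add: W_map_def)
  then have "iso D (top (\<rho> Q) \<cdot>\<^bsub>D\<^esub> top ?PU)"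
    using D.iso_Comp[OF h(1,4) iso_top[OF PQ(1)]] nat by simp
  then have "iso D (top ?PU)"
    using D.iso_cancel_left[OF h(3,2) iso_top[OF PQ(2)]] by simp
  then have "iso D (FArr U (top w))"
    by (simp add: Pt_map_def pt_arr.map_sel)
  then show ?thesis using cons tw by (auto simp: conservative_def hom_def)
qed

section \<open>Protomodularity\<close>

theorem lemma3p1:
  fixes C :: "('o1, 'm1) cat" and D :: "('o2, 'm2) cat"
    and U :: "('o1, 'm1, 'o2, 'm2) funct"
    and \<kappa> :: "'m1 \<Rightarrow> 'm1" and p q :: "'o2 \<Rightarrow> 'o2 \<Rightarrow> 'm2"
    and \<rho> :: "'m1 \<times> 'm1 \<Rightarrow> 'm2 pt_arr"
  assumes "finitely_complete C" and "pointed C"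
    and "finitely_complete D" and "pointed D"
    and "left_exact C D U"
    and "kernel_choice C \<kappa>" and "product_choice D p q"
    and "semi_direct_index C D \<kappa> p q U \<rho>"
    and "conservative C D U"
  shows "protomodular C"
  unfolding protomodular_def
proof (intro conjI ballI impI)
  show "finitely_complete C" by fact
next
  note PC = \<open>pointed C\<close> and \<kappa> = \<open>kernel_choice C \<kappa>\<close>
  interpret category C using PC by (simp add: pointed_def)
  interpret PtC: category "Pt C" by (rule category_Pt)
  fix a b assume "a \<in> Arr (Pt C)" "b \<in> Arr (Pt C)"
    and ab: "tgt a = src b \<and> pt_pullback C a \<and> pt_pullback C (b \<cdot>\<^bsub>Pt C\<^esub> a)"
  then have a: "a \<in> hom (Pt C) (src a) (src b)" and b: "b \<in> hom (Pt C) (src b) (tgt b)"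
    by (auto simp: hom_def Pt_def)
  obtain f s g t where S: "src b = (f, s)" "tgt b = (g, t)" by (metis surj_pair)
  obtain x y where B: "b = PtArr (f, s) (g, t) x y" "split_epi C f s" "split_epi C g t"
    "x \<in> hom C (Dom C f) (Dom C g)" "y \<in> hom C (Cod C f) (Cod C g)"
    "g \<cdot>\<^bsub>C\<^esub> x = y \<cdot>\<^bsub>C\<^esub> f" "x \<cdot>\<^bsub>C\<^esub> s = t \<cdot>\<^bsub>C\<^esub> y"
    using b unfolding S Pt_hom_iff by blast
  have kh: "ker_map C \<kappa> d \<in> hom C (Dom C (\<kappa> (fst P))) (Dom C (\<kappa> (fst Q)))"
    if "d \<in> hom (Pt C) P Q" for d P Q
    using ker_map_unique[OF PC \<kappa>, of d "fst P" "snd P" "fst Q" "snd Q" "ker_map C \<kappa> d"] that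
    by simp
  have "iso C (ker_map C \<kappa> a)" "iso C (ker_map C \<kappa> (b \<cdot>\<^bsub>Pt C\<^esub> a))"
    using iso_ker_map_pt_pullback[OF PC \<kappa>] a PtC.Comp_hom[OF a b] ab by blast+
  \<comment> \<open>By \<open>ker_map_Comp\<close> the kernel arrow of the composite is that of
    \<open>b\<close> after that of \<open>a\<close>, and both of these known arrows are
    invertible.\<close>
  then have kb: "iso C (ker_map C \<kappa> b)"
    using iso_cancel_right[OF kh[OF a] kh[OF b]] ker_map_Comp[OF PC \<kappa> a b] by simp

  have g: "g \<in> hom C (Dom C g) (Cod C g)" and t: "t \<in> hom C (Cod C g) (Dom C g)"
    and f: "f \<in> hom C (Dom C f) (Cod C f)" and s: "s \<in> hom C (Cod C f) (Dom C f)"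
    using split_epi_hom[OF B(2)] split_epi_hom[OF B(3)] by auto
  \<comment> \<open>The base change of \<open>g\<close> along the base arrow \<open>y\<close> of
    \<open>b\<close>; \<open>f'\<close> is the projection to \<open>Cod C f\<close>.\<close>
  obtain x' f' where PB: "pullback_square C x' f' g y"
    using finitely_complete_pullback[OF \<open>finitely_complete C\<close> g B(5)] .
  have y: "Dom C y = Cod C f" using B(5) by (simp add: hom_def)
  let ?P = "Dom C x'" and ?Y = "Cod C f"
  have x': "x' \<in> hom C ?P (Dom C g)" and f': "f' \<in> hom C ?P ?Y" and sq: "g \<cdot>\<^bsub>C\<^esub> x' = y \<cdot>\<^bsub>C\<^esub> f'"
    using pullback_squareD[OF PB] y by simp_all
  then have f'd: "Dom C f' = ?P" "Cod C f' = ?Y" by (simp_all add: hom_def)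
  have Y: "?Y \<in> Obj C" using hom_Obj f by blast
  have lift: "\<exists>u. u \<in> hom C T ?P \<and> x' \<cdot>\<^bsub>C\<^esub> u = c \<and> f' \<cdot>\<^bsub>C\<^esub> u = d"
    if "c \<in> hom C T (Dom C g)" "d \<in> hom C T ?Y" "g \<cdot>\<^bsub>C\<^esub> c = y \<cdot>\<^bsub>C\<^esub> d" for T c d
    using PB that unfolding pullback_square_def y by blast
  \<comment> \<open>This makes \<open>t \<cdot> y\<close> and the identity a cone over
    \<open>g\<close> and \<open>y\<close>; the induced arrow \<open>s'\<close> is the section of
    \<open>f'\<close> that \<open>x'\<close> carries to \<open>t\<close>.\<close>
  have gty: "g \<cdot>\<^bsub>C\<^esub> (t \<cdot>\<^bsub>C\<^esub> y) = y"
    using assoc[OF B(5) t g] B(3) Id_left[OF B(5)] by (simp add: split_epi_def)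
  then obtain s' where s': "s' \<in> hom C ?Y ?P" "x' \<cdot>\<^bsub>C\<^esub> s' = t \<cdot>\<^bsub>C\<^esub> y" "f' \<cdot>\<^bsub>C\<^esub> s' = Id C ?Y"
    using lift[OF Comp_hom[OF B(5) t] Id_hom[OF Y]] Id_right[OF B(5)] by auto
  \<comment> \<open>The comparison from the left edge of \<open>b\<close> into the base change,
    induced by the commuting square of \<open>b\<close>.\<close>
  obtain w where w: "w \<in> hom C (Dom C f) ?P" "x' \<cdot>\<^bsub>C\<^esub> w = x" "f' \<cdot>\<^bsub>C\<^esub> w = f"
    using lift[OF B(4) f B(6)] by blast
  \<comment> \<open>Compatibility with the sections, needed for \<open>w\<close> to be the top of a
    morphism in \<open>Pt C\<close>.\<close>
  have ws: "w \<cdot>\<^bsub>C\<^esub> s = s'"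
  proof (rule pullback_square_joint_monic[OF PB Comp_hom[OF s w(1)] s'(1)])
    show "x' \<cdot>\<^bsub>C\<^esub> (w \<cdot>\<^bsub>C\<^esub> s) = x' \<cdot>\<^bsub>C\<^esub> s'"
      using assoc[OF s w(1) x'] w(2) s'(2) B(7) by simp
    show "f' \<cdot>\<^bsub>C\<^esub> (w \<cdot>\<^bsub>C\<^esub> s) = f' \<cdot>\<^bsub>C\<^esub> s'"
      using assoc[OF s w(1) f'] w(3) s'(3) B(2) by (simp add: split_epi_def)
  qed
  have se: "split_epi C f' s'"
    using s' f' f'd by (simp add: split_epi_def hom_def)
  \<comment> \<open>\<open>b\<close> factors as \<open>?w\<close>, which fixes the base, followed by
    the pullback square \<open>?c\<close>.\<close>
  let ?w = "PtArr (f, s) (f', s') w (Id C ?Y)" and ?c = "PtArr (f', s') (g, t) x' y"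
  have hw: "?w \<in> hom (Pt C) (f, s) (f', s')"
    unfolding Pt_hom_iff f'd
    using B(2) se w ws Id_hom[OF Y] Id_left[OF f] Id_right[OF s'(1)] by simp
  have hc: "?c \<in> hom (Pt C) (f', s') (g, t)"
    unfolding Pt_hom_iff f'd using B(3,5) se x' sq s' by simp
  have cw: "?c \<cdot>\<^bsub>Pt C\<^esub> ?w = b"
    using B(1) w(2) Id_right[OF B(5)] by simp
  have "iso C (ker_map C \<kappa> ?c)"
    using iso_ker_map_pt_pullback[OF PC \<kappa> hc] PB by (simp add: pt_pullback_def)
  \<comment> \<open>The kernel arrow of \<open>b\<close> is that of \<open>?c\<close> after that of
    \<open>?w\<close>; the first two are invertible, hence also the third.\<close>
  then have kw: "iso C (ker_map C \<kappa> ?w)"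
    using iso_cancel_left[OF kh[OF hw] kh[OF hc]] kb ker_map_Comp[OF PC \<kappa> hw hc] cw by simp
  have "iso C (Id C ?Y)"
    using iso_iff_inverse[OF Id_hom[OF Y]] Id_hom[OF Y] Id_left[OF Id_hom[OF Y]] by blast
  then have "iso C w"
    using semi_direct_index_iso_top[OF PC \<kappa> assms(7-9) hw _ kw] by simp
  \<comment> \<open>Composing the projections \<open>x'\<close> and \<open>f'\<close> with
    \<open>w\<close> gives back \<open>x\<close> and \<open>f\<close>, so the square of
    \<open>b\<close> is the chosen pullback up to the isomorphism \<open>w\<close>.\<close>
  then show "pt_pullback C b"
    using pullback_square_Comp_iso[OF PB w(1)] w B(1) by (simp add: pt_pullback_def)
qed

end
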